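(* Let $(E,(\cdot,\cdot),\mathcal H)$ be an extended affine Lie algebra (of reduced type) with root system $R$ of type $C_\ell$ ($\ell\geq 3$), $F_4$ or $G_2$. Then any finite order Cartan automorphism $\Psi$ of $E$ is diagonal, and the corresponding map $\psi:R\to\mathbb C^\times$ (the core-character associated to $\Psi$) is a character.
   Context: All vector spaces are over $\mathbb C$. An extended affine Lie algebra is a triple $(E,(\cdot,\cdot),\mathcal H)$ where $E$ is a Lie algebra, $\mathcal H$ is a non-trivial finite dimensional subalgebra and $(\cdot,\cdot)$ is a symmetric bilinear form on $E$ such that: (A1) the form is invariant and non-degenerate; (A2) $E=\sum_{\alpha\in R}E_\alpha$ with $E_\alpha=\{x\in E\mid [h,x]=\alpha(h)x\ \forall h\in\mathcal H\}$, $R=\{\alpha\in\mathcal H^\star\mid E_\alpha\neq\{0\}\}$ and $E_0=\mathcal H$ ($R$ is the root system of $E$); the form restricted to $\mathcal H$ is then non-degenerate, $t_\alpha\in\mathcal H$ is defined by $\alpha(h)=(h,t_\alpha)$, and $(\alpha,\beta):=(t_\alpha,t_\beta)$ on $\mathcal H^\star$; $R^0=\{\alpha\in R\mid(\alpha,\alpha)=0\}$ (isotropic roots), $R^\times=R\setminus R^0$ (non-isotropic roots), and the core $E_c$ is the subalgebra generated by $E_\alpha$, $\alpha\in R^\times$; (A3) $\mathrm{ad}(x)$ is locally nilpotent for $x\in E_\alpha$, $\alpha\in R^\times$; (A4) (tameness) the centralizer of $E_c$ in $E$ is contained in $E_c$; (A5) the $\mathbb Z$-span of $R$ is a free abelian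 group of finite rank; (A6) if $R^\times=R_1\uplus R_2$ with $R_1,R_2$ non-empty then $R_1\not\perp R_2$. Let $\mathcal V=\mathrm{span}_{\mathbb R}R$, $\mathcal V^0=\mathrm{span}_{\mathbb R}R^0$. The image $\bar R$ of $R$ in $\mathcal V/\mathcal V^0$ is an irreducible finite root system; its rank and type are called the rank and type of $R$ (and of $E$). Reduced type means $\bar R$ is reduced. A Cartan automorphism of $E$ is an automorphism $\Psi$ with $\Psi(h)=h$ for all $h\in\mathcal H$; it stabilizes each root space. It is diagonal if it acts as a scalar multiple of the identity on each root space. For $\alpha\in R^\times$ ($\dim E_\alpha=1$) define $\eta_\alpha\in\mathbb C^\times$ by $\Psi(x)=\eta_\alpha x$, $x\in E_\alpha$. If $\Psi$ is a finite order diagonal automorphism, its associated core-character is $\psi:R\to\mathbb C^\times$, $\psi(\alpha)=\eta_\alpha$, where for $\sigma\in R^0$, $\eta_\sigma:=\eta_{\alpha+\sigma}\eta_{-\alpha}$ for some $\alpha\in R^\times$ with $\alpha+\sigma\in R^\times$ (such $\alpha$ exists and the value does not depend on its choice). A map $\psi:R\to\mathbb C^\times$ is a core-character if $\psi(\alpha+\beta)=\psi(\alpha)\psi(\beta)$ whenever $\alpha\in R^\times$, $\beta,\alpha+\beta\in R$; it is a character if $\psi(\alpha+\beta)=\psi(\alpha)\psi(\beta)$ whenever $\alpha,\beta,\alpha+\beta\in R$. *)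

theory Defs
  imports Complex_Main "HOL-Library.Function_Algebras"
begin

definition scale_fun :: "real \<Rightarrow> ('i \<Rightarrow> 'v::real_vector) \<Rightarrow> 'i \<Rightarrow> 'v"
  where "scale_fun r f = (\<lambda>x. r *\<^sub>R f x)"

definition int_scale_fun :: "int \<Rightarrow> ('i \<Rightarrow> complex) \<Rightarrow> 'i \<Rightarrow> complex"
  where "int_scale_fun n f = (\<lambda>x. of_int n * f x)"

global_interpretation real_fun: vector_space "scale_fun :: real \<Rightarrow> ('i \<Rightarrow> 'v::real_vector) \<Rightarrow> 'i \<Rightarrow> 'v"
  by standard
    (auto simp: scale_fun_def fun_eq_iff scaleR_add_left scaleR_add_right)

global_interpretation int_fun: module "int_scale_fun :: int \<Rightarrow> ('i \<Rightarrow> complex) \<Rightarrow> 'i \<Rightarrow> complex"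
  by standard (auto simp: int_scale_fun_def fun_eq_iff algebra_simps)

text \<open>
  The usual realisations, without \<open>0\<close>. The space \<open>\<real>\<^sup>n\<close> is represented by the functions
  \<open>nat \<Rightarrow> real\<close> vanishing outside \<open>{..<n}\<close>, so that the rank can be a variable.
\<close>

definition unit_vec :: "nat \<Rightarrow> nat \<Rightarrow> real"
  where "unit_vec i = (\<lambda>j. if j = i then 1 else 0)"

definition roots_C :: "nat \<Rightarrow> (nat \<Rightarrow> real) set"
  where "roots_C l =
    {scale_fun a (unit_vec i) + scale_fun b (unit_vec j) | a b i j.
       i < l \<and> j < l \<and> i \<noteq> j \<and> a \<in> {1, -1} \<and> b \<in> {1, -1}} \<union>
    {scale_fun a (unit_vec i) | a i. i < l \<and> a \<in> {2, -2}}"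

definition roots_F4 :: "(nat \<Rightarrow> real) set"
  where "roots_F4 =
    {scale_fun a (unit_vec i) | a i. i < 4 \<and> a \<in> {1, -1}} \<union>
    {scale_fun a (unit_vec i) + scale_fun b (unit_vec j) | a b i j.
       i < 4 \<and> j < 4 \<and> i \<noteq> j \<and> a \<in> {1, -1} \<and> b \<in> {1, -1}} \<union>
    {v. (\<forall>i<4. v i \<in> {1/2, -1/2}) \<and> (\<forall>i\<ge>4. v i = 0)}"

text \<open>Realised in the plane of vectors of \<open>\<real>\<^sup>3\<close> with coordinate sum \<open>0\<close>.\<close>

definition roots_G2 :: "(nat \<Rightarrow> real) set"
  where "roots_G2 =
    {unit_vec i - unit_vec j | i j. i < 3 \<and> j < 3 \<and> i \<noteq> j} \<union>
    {scale_fun a (scale_fun 2 (unit_vec i) - unit_vec j - unit_vec k) | a i j k.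
       {i, j, k} = {0, 1, 2} \<and> a \<in> {1, -1}}"

locale lie_algebra = vector_space scale
  for scale :: "complex \<Rightarrow> 'e::ab_group_add \<Rightarrow> 'e" +
  fixes bracket :: "'e \<Rightarrow> 'e \<Rightarrow> 'e"
  assumes linear_bracket_left: "Vector_Spaces.linear scale scale (\<lambda>x. bracket x y)"
    and linear_bracket_right: "Vector_Spaces.linear scale scale (bracket x)"
    and bracket_self: "bracket x x = 0"
    and jacobi: "bracket x (bracket y z) + bracket y (bracket z x) + bracket z (bracket x y) = 0"
begin

definition lie_subalgebra :: "'e set \<Rightarrow> bool"
  where "lie_subalgebra S \<longleftrightarrow> subspace S \<and> (\<forall>x\<in>S. \<forall>y\<in>S. bracket x y \<in> S)"

definition centralizer :: "'e set \<Rightarrow> 'e set"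
  where "centralizer S = {x. \<forall>y\<in>S. bracket x y = 0}"

definition lie_automorphism :: "('e \<Rightarrow> 'e) \<Rightarrow> bool"
  where "lie_automorphism \<Psi> \<longleftrightarrow>
    Vector_Spaces.linear scale scale \<Psi> \<and> bij \<Psi> \<and>
    (\<forall>x y. \<Psi> (bracket x y) = bracket (\<Psi> x) (\<Psi> y))"

end

definition finite_order :: "('a \<Rightarrow> 'a) \<Rightarrow> bool"
  where "finite_order f \<longleftrightarrow> (\<exists>n>0. f ^^ n = id)"

locale lie_algebra_with_form = lie_algebra scale bracket
  for scale :: "complex \<Rightarrow> 'e::ab_group_add \<Rightarrow> 'e"
    and bracket :: "'e \<Rightarrow> 'e \<Rightarrow> 'e" +
  fixes form :: "'e \<Rightarrow> 'e \<Rightarrow> complex"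
    and H :: "'e set"
begin

text \<open>
  A linear functional on \<open>H\<close> is represented by its extension by \<open>0\<close> outside \<open>H\<close>; hence
  equality and the pointwise operations on functions are those of the dual space of \<open>H\<close>.
\<close>

definition dual :: "('e \<Rightarrow> complex) set"
  where "dual = {\<alpha>. (\<forall>x. x \<notin> H \<longrightarrow> \<alpha> x = 0) \<and>
    (\<forall>x\<in>H. \<forall>y\<in>H. \<alpha> (x + y) = \<alpha> x + \<alpha> y) \<and>
    (\<forall>c. \<forall>x\<in>H. \<alpha> (scale c x) = c * \<alpha> x)}"

definition root_space :: "('e \<Rightarrow> complex) \<Rightarrow> 'e set"
  where "root_space \<alpha> = {x. \<forall>h\<in>H. bracket h x = scale (\<alpha> h) x}"

definition roots :: "('e \<Rightarrow> complex) set"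
  where "roots = {\<alpha> \<in> dual. root_space \<alpha> \<noteq> {0}}"

definition dual_vec :: "('e \<Rightarrow> complex) \<Rightarrow> 'e"
  where "dual_vec \<alpha> = (THE t. t \<in> H \<and> (\<forall>h\<in>H. \<alpha> h = form h t))"

definition dual_form :: "('e \<Rightarrow> complex) \<Rightarrow> ('e \<Rightarrow> complex) \<Rightarrow> complex"
  where "dual_form \<alpha> \<beta> = form (dual_vec \<alpha>) (dual_vec \<beta>)"

definition isotropic_roots :: "('e \<Rightarrow> complex) set"
  where "isotropic_roots = {\<alpha> \<in> roots. dual_form \<alpha> \<alpha> = 0}"

definition nonisotropic_roots :: "('e \<Rightarrow> complex) set"
  where "nonisotropic_roots = roots - isotropic_roots"

definition core :: "'e set"
  where "core = lie_subalgebra hull (\<Union>\<alpha>\<in>nonisotropic_roots. root_space \<alpha>)"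

definition root_real_span :: "('e \<Rightarrow> complex) set"
  where "root_real_span = real_fun.span roots"

definition isotropic_real_span :: "('e \<Rightarrow> complex) set"
  where "isotropic_real_span = real_fun.span isotropic_roots"

text \<open>
  The quotient of \<open>root_real_span\<close> by \<open>isotropic_real_span\<close> is the set of cosets
  \<open>quot_class ` root_real_span\<close>.
\<close>

definition quot_class :: "('e \<Rightarrow> complex) \<Rightarrow> ('e \<Rightarrow> complex) set"
  where "quot_class v = {v + w | w. w \<in> isotropic_real_span}"

definition quot_roots :: "('e \<Rightarrow> complex) set set"
  where "quot_roots = quot_class ` roots"

text \<open>
  Isomorphism of root systems with a standard one determines both type and rank:
  the image of the roots in the quotient, which contains \<open>0\<close>, is isomorphic to \<open>\<Phi>\<close> together
  with \<open>0\<close>, by a linear isomorphism from the quotient space onto the span of \<open>\<Phi>\<close>.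
\<close>

definition has_type :: "(nat \<Rightarrow> real) set \<Rightarrow> bool"
  where "has_type \<Phi> \<longleftrightarrow>
    (\<exists>g. bij_betw g (quot_class ` root_real_span) (real_fun.span \<Phi>) \<and>
      (\<forall>u\<in>root_real_span. \<forall>v\<in>root_real_span.
         g (quot_class (u + v)) = g (quot_class u) + g (quot_class v)) \<and>
      (\<forall>r. \<forall>v\<in>root_real_span.
         g (quot_class (scale_fun r v)) = scale_fun r (g (quot_class v))) \<and>
      g ` quot_roots = insert 0 \<Phi>)"

definition reduced_type :: bool
  where "reduced_type \<longleftrightarrow>
    (\<forall>\<alpha>\<in>roots. quot_class \<alpha> \<noteq> quot_class 0 \<longrightarrow>
      (\<forall>r. quot_class (scale_fun r \<alpha>) \<in> quot_roots \<longrightarrow> r \<in> {0, 1, -1}))"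

definition cartan_automorphism :: "('e \<Rightarrow> 'e) \<Rightarrow> bool"
  where "cartan_automorphism \<Psi> \<longleftrightarrow> lie_automorphism \<Psi> \<and> (\<forall>h\<in>H. \<Psi> h = h)"

definition diagonal :: "('e \<Rightarrow> 'e) \<Rightarrow> bool"
  where "diagonal \<Psi> \<longleftrightarrow> (\<forall>\<alpha>\<in>roots. \<exists>c. \<forall>x\<in>root_space \<alpha>. \<Psi> x = scale c x)"

definition root_eigenvalue :: "('e \<Rightarrow> 'e) \<Rightarrow> ('e \<Rightarrow> complex) \<Rightarrow> complex"
  where "root_eigenvalue \<Psi> \<alpha> = (THE c. \<forall>x\<in>root_space \<alpha>. \<Psi> x = scale c x)"

text \<open>
  For isotropic \<open>\<alpha>\<close> the value does not depend on the \<open>\<beta>\<close> chosen. Diagonality makes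
  \<open>root_eigenvalue\<close> well defined, since root spaces of roots are nonzero.
\<close>

definition assoc_core_character :: "('e \<Rightarrow> 'e) \<Rightarrow> ('e \<Rightarrow> complex) \<Rightarrow> complex"
  where "assoc_core_character \<Psi> \<alpha> =
    (if \<alpha> \<in> nonisotropic_roots then root_eigenvalue \<Psi> \<alpha>
     else let \<beta> = (SOME \<beta>. \<beta> \<in> nonisotropic_roots \<and> \<beta> + \<alpha> \<in> nonisotropic_roots)
          in root_eigenvalue \<Psi> (\<beta> + \<alpha>) * root_eigenvalue \<Psi> (- \<beta>))"

definition is_character :: "(('e \<Rightarrow> complex) \<Rightarrow> complex) \<Rightarrow> bool"
  where "is_character \<psi> \<longleftrightarrow>
    (\<forall>\<alpha>\<in>roots. \<psi> \<alpha> \<noteq> 0) \<and>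
    (\<forall>\<alpha>\<in>roots. \<forall>\<beta>\<in>roots. \<alpha> + \<beta> \<in> roots \<longrightarrow> \<psi> (\<alpha> + \<beta>) = \<psi> \<alpha> * \<psi> \<beta>)"

end

locale extended_affine_lie_algebra = lie_algebra_with_form scale bracket form H
  for scale :: "complex \<Rightarrow> 'e::ab_group_add \<Rightarrow> 'e"
    and bracket :: "'e \<Rightarrow> 'e \<Rightarrow> 'e"
    and form :: "'e \<Rightarrow> 'e \<Rightarrow> complex"
    and H :: "'e set" +
  assumes H_subalgebra: "lie_subalgebra H"
    and H_nontrivial: "H \<noteq> {0}"
    and H_finite_dim: "\<exists>B. finite B \<and> span B = H"
    and linear_form: "Vector_Spaces.linear scale (*) (form x)"
    and form_sym: "form x y = form y x"
    and form_invariant: "form (bracket x y) z = form x (bracket y z)"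
    and form_nondegenerate: "(\<And>y. form x y = 0) \<Longrightarrow> x = 0"
    and root_decomposition: "span (\<Union>\<alpha>\<in>roots. root_space \<alpha>) = UNIV"
    and root_space_zero: "root_space 0 = H"
    and ad_locally_nilpotent:
      "\<alpha> \<in> nonisotropic_roots \<Longrightarrow> x \<in> root_space \<alpha> \<Longrightarrow> \<exists>n. (bracket x ^^ n) y = 0"
    and tame: "centralizer core \<subseteq> core"
    and root_lattice_free:
      "\<exists>B. finite B \<and> int_fun.independent B \<and> int_fun.span B = int_fun.span roots"
    and irreducible:
      "nonisotropic_roots = R1 \<union> R2 \<Longrightarrow> R1 \<inter> R2 = {} \<Longrightarrow> R1 \<noteq> {} \<Longrightarrow> R2 \<noteq> {} \<Longrightarrow>
         \<exists>\<alpha>\<in>R1. \<exists>\<beta>\<in>R2. dual_form \<alpha> \<beta> \<noteq> 0"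

end

theory Submission
  imports Defs
begin

text \<open>
  A Cartan automorphism \<open>\<Psi>\<close> acts by a scalar \<open>\<eta>(\<alpha>)\<close> on each non-isotropic root space, since these
  are one-dimensional by the representation theory of \<open>sl\<^sub>2\<close>, and \<open>\<eta>\<close> is multiplicative on
  non-isotropic roots with non-isotropic sum, since the brackets of their root vectors do not vanish
  (\<open>nonisotropic_root_space_dim_1\<close>, \<open>bracket_nonisotropic_nonzero\<close>). Everything else depends on one
  statement about roots: for an isotropic \<open>\<sigma>\<close>, the ratio \<open>\<eta>(\<alpha> + \<sigma>) / \<eta>(\<alpha>)\<close> is the same for all
  non-isotropic \<open>\<alpha>\<close> such that \<open>\<alpha> + \<sigma>\<close> is a root (\<open>shift_ratio_unique\<close>).

  If \<open>\<gamma>\<close> is a non-isotropic root with \<open>2 (\<alpha>, \<gamma>) / (\<gamma>, \<gamma>) < 0\<close>, then \<open>\<alpha> + \<gamma>\<close> and \<open>\<alpha> + \<sigma> + \<gamma>\<close> are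
  roots, because isotropic roots are orthogonal to all roots (\<open>isotropic_orthogonal\<close>); if they are non-isotropic,
  multiplicativity gives \<open>\<alpha> + \<gamma>\<close> the same ratio as \<open>\<alpha>\<close>. Such obtuse steps are visible in the finite
  root system \<open>\<Phi>\<close> below the extended affine one (\<open>obtuse_pairing\<close>). In types C (of rank at least 3),
  F and G, every root of \<open>\<Phi>\<close> leads by obtuse steps to one short root \<open>a\<close>, the hub, and \<open>a\<close> lies in a
  subsystem of type \<open>A\<^sub>2\<close> of short roots. The latter permits a passage between any two roots of the
  algebra above \<open>a\<close> by obtuse steps (\<open>shift_at_hub\<close>). So the ratios agree, and moreover every
  isotropic root can be added to every root above \<open>a\<close>. The second fact yields
  \<open>\<psi>(\<sigma> + \<tau>) = \<psi>(\<sigma>) \<psi>(\<tau>)\<close> for isotropic \<open>\<sigma>\<close>, \<open>\<tau>\<close>: compare \<open>\<alpha>\<close>, \<open>\<alpha> + \<sigma>\<close> and \<open>\<alpha> + \<sigma> + \<tau>\<close> above the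
  hub. The other instances of the character property follow from the definition of \<open>\<psi>\<close>.

  For \<open>x\<close> in the root space of an isotropic \<open>\<sigma>\<close>, the vector \<open>z = \<Psi> x - \<psi>(\<sigma>) x\<close> centralizes the core
  by the constancy of the ratio, so it lies in the core by tameness. There the root space of \<open>\<sigma>\<close> is
  spanned by brackets of non-isotropic root vectors, whence \<open>\<Psi> z = \<psi>(\<sigma>) z\<close>. As \<open>\<Psi>\<close> has finite order
  it has no nontrivial Jordan block, and \<open>z = 0\<close> (\<open>\<Psi>_isotropic\<close>).
\<close>

section \<open>Root spaces\<close>

context lie_algebra
begin

lemma bracket_add_left: "bracket (x + y) z = bracket x z + bracket y z"
  and bracket_scale_left: "bracket (scale c x) z = scale c (bracket x z)"
  and bracket_diff_left: "bracket (x - y) z = bracket x z - bracket y z"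
  and bracket_zero_left [simp]: "bracket 0 z = 0"
proof -
  interpret l: Vector_Spaces.linear scale scale "\<lambda>x. bracket x z"
    by (rule linear_bracket_left)
  show "bracket (x + y) z = bracket x z + bracket y z"
    "bracket (scale c x) z = scale c (bracket x z)"
    "bracket (x - y) z = bracket x z - bracket y z"
    "bracket 0 z = 0"
    by (rule l.add l.scale l.diff l.zero)+
qed

lemma bracket_add_right: "bracket x (y + z) = bracket x y + bracket x z"
  and bracket_scale_right: "bracket x (scale c y) = scale c (bracket x y)"
  and bracket_diff_right: "bracket x (y - z) = bracket x y - bracket x z"
  and bracket_minus_right: "bracket x (- y) = - bracket x y"
  and bracket_zero_right [simp]: "bracket x 0 = 0"
proof -
  interpret r: Vector_Spaces.linear scale scale "bracket x"
    by (rule linear_bracket_right)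
  show "bracket x (y + z) = bracket x y + bracket x z"
    "bracket x (scale c y) = scale c (bracket x y)"
    "bracket x (y - z) = bracket x y - bracket x z"
    "bracket x (- y) = - bracket x y"
    "bracket x 0 = 0"
    by (rule r.add r.scale r.diff r.neg r.zero)+
qed

lemma bracket_skew: "bracket x y = - bracket y x"
proof -
  have "bracket x y + bracket y x = bracket (x + y) (x + y)"
    unfolding bracket_add_left bracket_add_right by (simp add: bracket_self add.commute)
  then have "bracket x y + bracket y x = 0"
    by (simp only: bracket_self)
  then show ?thesis
    by (simp only: eq_neg_iff_add_eq_0)
qed

lemma bracket_derivation:
  "bracket x (bracket y z) = bracket (bracket x y) z + bracket y (bracket x z)"
proof -
  have "bracket y (bracket z x) = - bracket y (bracket x z)"
    using bracket_skew[of z x] bracket_minus_right by metis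
  moreover have "bracket z (bracket x y) = - bracket (bracket x y) z"
    by (rule bracket_skew)
  ultimately show ?thesis
    using jacobi[of x y z] by (simp add: algebra_simps)
qed

end

context extended_affine_lie_algebra
begin

lemma form_add_right: "form x (y + z) = form x y + form x z"
  and form_scale_right: "form x (scale c y) = c * form x y"
  and form_zero_right [simp]: "form x 0 = 0"
proof -
  interpret r: Vector_Spaces.linear scale "(*)" "form x"
    by (rule linear_form)
  show "form x (y + z) = form x y + form x z"
    "form x (scale c y) = c * form x y" "form x 0 = 0"
    by (rule r.add r.scale r.zero)+
qed

lemma form_add_left: "form (x + y) z = form x z + form y z"
  and form_scale_left: "form (scale c x) z = c * form x z"
  and form_zero_left [simp]: "form 0 z = 0"
  by (simp_all add: form_sym[of _ z] form_add_right form_scale_right)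

lemma form_diff_left: "form (x - y) z = form x z - form y z"
  using form_add_left[of "x - y" y z] by simp

lemma subspace_H: "subspace H"
  using H_subalgebra by (simp add: lie_subalgebra_def)

lemma dual_scale: "\<alpha> \<in> dual \<Longrightarrow> h \<in> H \<Longrightarrow> \<alpha> (scale c h) = c * \<alpha> h"
  by (auto simp: dual_def)

lemma dual_add: "\<alpha> \<in> dual \<Longrightarrow> \<beta> \<in> dual \<Longrightarrow> \<alpha> + \<beta> \<in> dual"
  and dual_diff: "\<alpha> \<in> dual \<Longrightarrow> \<beta> \<in> dual \<Longrightarrow> \<alpha> - \<beta> \<in> dual"
  and dual_uminus: "\<alpha> \<in> dual \<Longrightarrow> - \<alpha> \<in> dual"
  and dual_zero: "0 \<in> dual"
  and dual_scale_fun: "\<alpha> \<in> dual \<Longrightarrow> scale_fun r \<alpha> \<in> dual"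
  by (simp_all add: dual_def scale_fun_def scaleR_conv_of_real algebra_simps)

lemma dual_neqE:
  assumes "\<alpha> \<in> dual" "\<beta> \<in> dual" "\<alpha> \<noteq> \<beta>"
  obtains h where "h \<in> H" "\<alpha> h \<noteq> \<beta> h"
proof -
  obtain h where "\<alpha> h \<noteq> \<beta> h"
    using assms(3) by (auto simp: fun_eq_iff)
  then show ?thesis
    using assms(1,2) that[of h] unfolding dual_def by (cases "h \<in> H") auto
qed

lemma roots_dual: "\<alpha> \<in> roots \<Longrightarrow> \<alpha> \<in> dual"
  by (simp add: roots_def)

lemma rootI: "\<alpha> \<in> dual \<Longrightarrow> x \<in> root_space \<alpha> \<Longrightarrow> x \<noteq> 0 \<Longrightarrow> \<alpha> \<in> roots"
  by (auto simp: roots_def)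

lemma zero_in_root_space [simp]: "0 \<in> root_space \<alpha>"
  by (simp add: root_space_def)

lemma root_spaceE:
  assumes "\<alpha> \<in> roots"
  obtains x where "x \<in> root_space \<alpha>" "x \<noteq> 0"
  using assms zero_in_root_space[of \<alpha>] by (auto simp: roots_def)

lemma root_space_diff: "x \<in> root_space \<alpha> \<Longrightarrow> y \<in> root_space \<alpha> \<Longrightarrow> x - y \<in> root_space \<alpha>"
  and root_space_scale: "x \<in> root_space \<alpha> \<Longrightarrow> scale c x \<in> root_space \<alpha>"
  by (simp_all add: root_space_def bracket_scale_right bracket_diff_right
      scale_right_diff_distrib mult.commute)

lemma H_bracket: "h \<in> H \<Longrightarrow> x \<in> root_space \<alpha> \<Longrightarrow> bracket h x = scale (\<alpha> h) x"
  by (simp add: root_space_def)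

lemma bracket_root_space:
  assumes "x \<in> root_space \<alpha>" "y \<in> root_space \<beta>"
  shows "bracket x y \<in> root_space (\<alpha> + \<beta>)"
  using assms
  by (auto simp: root_space_def bracket_derivation[of _ x y] bracket_scale_right
      bracket_scale_left scale_left_distrib)

lemma form_root_spaces_orthogonal:
  assumes "\<alpha> \<in> dual" "\<beta> \<in> dual" "x \<in> root_space \<alpha>" "y \<in> root_space \<beta>" "\<beta> \<noteq> - \<alpha>"
  shows "form x y = 0"
proof -
  obtain h where h: "h \<in> H" "\<beta> h \<noteq> (- \<alpha>) h"
    using dual_neqE[OF assms(2) dual_uminus[OF assms(1)] assms(5)] by blast
  have "form (bracket x h) y = form x (bracket h y)"
    by (rule form_invariant)
  moreover have "bracket x h = scale (- \<alpha> h) x"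
    using H_bracket[OF h(1) assms(3)] bracket_skew[of x h] by simp
  ultimately have "- \<alpha> h * form x y = \<beta> h * form x y"
    using H_bracket[OF h(1) assms(4)] by (simp only: form_scale_left form_scale_right)
  then have "(\<beta> h + \<alpha> h) * form x y = 0"
    by (metis distrib_right minus_mult_left right_minus add.commute)
  then show ?thesis
    using h(2) by (simp add: eq_neg_iff_add_eq_0)
qed

text \<open>
  The form pairs a root space with the opposite one only, and root spaces span the algebra, so
  non-degeneracy is inherited by each such pair.
\<close>

lemma root_space_eq_0I:
  assumes "\<alpha> \<in> dual" "x \<in> root_space \<alpha>" "\<And>y. y \<in> root_space (- \<alpha>) \<Longrightarrow> form x y = 0"
  shows "x = 0"
proof (rule form_nondegenerate)
  fix y
  have "y \<in> span (\<Union>\<alpha>\<in>roots. root_space \<alpha>)"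
    by (simp add: root_decomposition)
  then show "form x y = 0"
  proof (induction rule: span_induct_alt)
    case (step c z w)
    then obtain \<beta> where "\<beta> \<in> roots" "z \<in> root_space \<beta>"
      by auto
    then have "form x z = 0"
      using form_root_spaces_orthogonal[OF assms(1) roots_dual assms(2)] assms(3)
      by (cases "\<beta> = - \<alpha>") auto
    with step show ?case
      by (simp add: form_add_right form_scale_right)
  qed simp
qed

lemma dual_root_vectorE:
  assumes "\<alpha> \<in> dual" "x \<in> root_space \<alpha>" "x \<noteq> 0"
  obtains y where "y \<in> root_space (- \<alpha>)" "form x y = c"
proof -
  obtain y where y: "y \<in> root_space (- \<alpha>)" "form x y \<noteq> 0"
    using root_space_eq_0I[OF assms(1,2)] assms(3) by blast
  then have "form x (scale (c / form x y) y) = c"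
    by (simp add: form_scale_right)
  then show ?thesis
    using that root_space_scale[OF y(1)] by blast
qed

lemma roots_uminus: "\<alpha> \<in> roots \<Longrightarrow> - \<alpha> \<in> roots"
proof -
  assume a: "\<alpha> \<in> roots"
  obtain x where x: "x \<in> root_space \<alpha>" "x \<noteq> 0"
    using root_spaceE[OF a] .
  obtain y where "y \<in> root_space (- \<alpha>)" "form x y = 1"
    using dual_root_vectorE[OF roots_dual[OF a] x] .
  moreover from this have "y \<noteq> 0"
    by auto
  ultimately show ?thesis
    using rootI[OF dual_uminus[OF roots_dual[OF a]]] by blast
qed

lemma H_eqI:
  assumes "s \<in> H" "t \<in> H" "\<And>h. h \<in> H \<Longrightarrow> form h s = form h t"
  shows "s = t"
proof -
  have "s - t \<in> root_space 0"
    using root_space_zero assms(1,2) subspace_diff[OF subspace_H] by simp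
  moreover have "form (s - t) h = 0" if "h \<in> root_space (- 0)" for h
    using that root_space_zero assms(3)[of h] by (simp add: form_diff_left form_sym[of s] form_sym[of t])
  ultimately have "s - t = 0"
    using root_space_eq_0I[OF dual_zero] by blast
  then show ?thesis by simp
qed

lemma dual_vec_eqI:
  assumes "t \<in> H" "\<And>h. h \<in> H \<Longrightarrow> \<alpha> h = form h t"
  shows "dual_vec \<alpha> = t"
  unfolding dual_vec_def
proof (rule the_equality)
  show "t \<in> H \<and> (\<forall>h\<in>H. \<alpha> h = form h t)"
    using assms by blast
  fix s assume "s \<in> H \<and> (\<forall>h\<in>H. \<alpha> h = form h s)"
  then show "s = t"
    by (intro H_eqI) (simp_all add: assms(1) flip: assms(2))
qed

lemma bracket_in_H: "x \<in> root_space \<alpha> \<Longrightarrow> y \<in> root_space (- \<alpha>) \<Longrightarrow> bracket x y \<in> H"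
  using bracket_root_space[of x \<alpha> y "- \<alpha>"] root_space_zero by simp

lemma form_H_bracket:
  assumes "x \<in> root_space \<alpha>" "y \<in> root_space (- \<alpha>)" "h \<in> H"
  shows "form h (bracket x y) = \<alpha> h * form x y"
  using form_invariant[of h x y] H_bracket[OF assms(3,1)] by (simp add: form_scale_left)

text \<open>
  If \<open>x \<in> E\<^sub>\<alpha>\<close> and \<open>y \<in> E\<^sub>-\<^sub>\<alpha>\<close> satisfy \<open>(x, y) = 1\<close>, then \<open>[x, y]\<close> represents \<open>\<alpha>\<close> by invariance.
\<close>

lemma dual_vec:
  assumes "\<alpha> \<in> roots"
  shows dual_vec_in_H: "dual_vec \<alpha> \<in> H"
    and form_dual_vec: "h \<in> H \<Longrightarrow> form h (dual_vec \<alpha>) = \<alpha> h"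
proof -
  obtain x where x: "x \<in> root_space \<alpha>" "x \<noteq> 0"
    using root_spaceE[OF assms] .
  obtain y where y: "y \<in> root_space (- \<alpha>)" "form x y = 1"
    using dual_root_vectorE[OF roots_dual[OF assms] x] .
  have "dual_vec \<alpha> = bracket x y"
    by (rule dual_vec_eqI) (simp_all add: bracket_in_H[OF x(1) y(1)] form_H_bracket[OF x(1) y(1)] y)
  then show "dual_vec \<alpha> \<in> H" "h \<in> H \<Longrightarrow> form h (dual_vec \<alpha>) = \<alpha> h"
    by (simp_all add: bracket_in_H[OF x(1) y(1)] form_H_bracket[OF x(1) y(1)] y)
qed

lemma bracket_opposite:
  assumes "\<alpha> \<in> roots" "x \<in> root_space \<alpha>" "y \<in> root_space (- \<alpha>)"
  shows "bracket x y = scale (form x y) (dual_vec \<alpha>)"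
  by (rule H_eqI)
    (simp_all add: bracket_in_H[OF assms(2,3)] subspace_scale[OF subspace_H] dual_vec[OF assms(1)]
      form_H_bracket[OF assms(2,3)] form_scale_right)

lemma dual_vec_uminus: "\<alpha> \<in> roots \<Longrightarrow> dual_vec (- \<alpha>) = - dual_vec \<alpha>"
  using form_scale_right[of _ "-1" "dual_vec \<alpha>"]
  by (intro dual_vec_eqI) (simp_all add: dual_vec subspace_neg[OF subspace_H])

lemma dual_vec_commute: "\<alpha> \<in> roots \<Longrightarrow> \<beta> \<in> roots \<Longrightarrow> \<alpha> (dual_vec \<beta>) = \<beta> (dual_vec \<alpha>)"
  using form_dual_vec[of \<beta> "dual_vec \<alpha>"] form_dual_vec[of \<alpha> "dual_vec \<beta>"]
  by (simp add: dual_vec_in_H form_sym)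

lemma dual_form_eq: "\<alpha> \<in> roots \<Longrightarrow> \<beta> \<in> roots \<Longrightarrow> dual_form \<alpha> \<beta> = \<alpha> (dual_vec \<beta>)"
  by (simp add: dual_form_def form_dual_vec dual_vec_in_H dual_vec_commute)

lemma isotropic_iff: "\<alpha> \<in> isotropic_roots \<longleftrightarrow> \<alpha> \<in> roots \<and> \<alpha> (dual_vec \<alpha>) = 0"
  by (auto simp: isotropic_roots_def dual_form_eq)

lemma nonisotropic_iff: "\<alpha> \<in> nonisotropic_roots \<longleftrightarrow> \<alpha> \<in> roots \<and> \<alpha> (dual_vec \<alpha>) \<noteq> 0"
  by (auto simp: nonisotropic_roots_def isotropic_iff)

lemma nonisotropic_root: "\<alpha> \<in> nonisotropic_roots \<Longrightarrow> \<alpha> \<in> roots"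
  by (simp add: nonisotropic_iff)

lemma dual_at_uminus: "\<alpha> \<in> dual \<Longrightarrow> h \<in> H \<Longrightarrow> \<alpha> (- h) = - \<alpha> h"
  using dual_scale[of \<alpha> h "-1"] by simp

lemma nonisotropic_uminus: "\<alpha> \<in> nonisotropic_roots \<Longrightarrow> - \<alpha> \<in> nonisotropic_roots"
  by (simp add: nonisotropic_iff roots_uminus dual_vec_uminus dual_at_uminus roots_dual dual_vec)

section \<open>Root strings\<close>

lemma funpow_root_space:
  assumes "f \<in> root_space \<gamma>" "w \<in> root_space \<beta>"
  shows "(bracket f ^^ j) w \<in> root_space (\<beta> + scale_fun (real j) \<gamma>)"
proof (induction j)
  case 0
  then show ?case
    using assms(2) by simp
next
  case (Suc j)
  have "\<gamma> + (\<beta> + scale_fun (real j) \<gamma>) = \<beta> + scale_fun (real (Suc j)) \<gamma>"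
    by (simp add: fun_eq_iff scale_fun_def scaleR_conv_of_real algebra_simps)
  then show ?case
    using bracket_root_space[OF assms(1) Suc] by (simp only: funpow.simps comp_apply)
qed

text \<open>
  With \<open>h = [e, f]\<close>, this is the action of \<open>sl\<^sub>2\<close> on a vector killed by \<open>e\<close> if \<open>\<alpha>(h) = 2\<close>. If
  \<open>\<alpha>(h) = 0\<close>, then \<open>h\<close> commutes with \<open>e\<close> and \<open>f\<close> as in a Heisenberg algebra, and the coefficients
  \<open>(j + 1) \<beta>(h)\<close> never vanish unless \<open>\<beta>(h) = 0\<close>.
\<close>

lemma ladder:
  fixes j :: nat
  assumes e: "e \<in> root_space \<alpha>" and f: "f \<in> root_space (- \<alpha>)"
    and w: "w \<in> root_space \<beta>" "bracket e w = 0"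
  shows "bracket e ((bracket f ^^ Suc j) w) =
    scale (of_nat (Suc j) * (\<beta> (bracket e f) - of_nat j * \<alpha> (bracket e f) / 2)) ((bracket f ^^ j) w)"
proof -
  have h: "bracket (bracket e f) ((bracket f ^^ j) w) =
      scale (\<beta> (bracket e f) - of_nat j * \<alpha> (bracket e f)) ((bracket f ^^ j) w)" for j
    using H_bracket[OF bracket_in_H[OF e f] funpow_root_space[OF f w(1), of j]]
    by (simp add: scale_fun_def scaleR_conv_of_real)
  show ?thesis
  proof (induction j)
    case 0
    then show ?case
      using h[of 0] by (simp add: bracket_derivation[of e f] w)
  next
    case (Suc j)
    have "bracket e ((bracket f ^^ Suc (Suc j)) w) =
        bracket (bracket e f) ((bracket f ^^ Suc j) w) + bracket f (bracket e ((bracket f ^^ Suc j) w))"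
      using bracket_derivation[of e f] by simp
    also have "\<dots> = scale ((\<beta> (bracket e f) - of_nat (Suc j) * \<alpha> (bracket e f)) +
        of_nat (Suc j) * (\<beta> (bracket e f) - of_nat j * \<alpha> (bracket e f) / 2)) ((bracket f ^^ Suc j) w)"
      unfolding h Suc by (simp add: bracket_scale_right scale_left_distrib)
    also have "(\<beta> (bracket e f) - of_nat (Suc j) * \<alpha> (bracket e f)) +
        of_nat (Suc j) * (\<beta> (bracket e f) - of_nat j * \<alpha> (bracket e f) / 2) =
        of_nat (Suc (Suc j)) * (\<beta> (bracket e f) - of_nat (Suc j) * \<alpha> (bracket e f) / 2)"
      by (simp add: field_simps)
    finally show ?case .
  qed
qed

lemma funpow_last_nonzeroE:
  assumes "(bracket x ^^ n) y = 0" "y \<noteq> 0"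
  obtains k where "(bracket x ^^ k) y \<noteq> 0" "bracket x ((bracket x ^^ k) y) = 0"
proof -
  define m where "m = (LEAST m. (bracket x ^^ m) y = 0)"
  have m: "(bracket x ^^ m) y = 0"
    unfolding m_def by (rule LeastI[of _ n]) (rule assms(1))
  with assms(2) obtain k where k: "m = Suc k"
    by (cases m) auto
  then have "(bracket x ^^ k) y \<noteq> 0"
    unfolding m_def by (metis (mono_tags, lifting) lessI not_less_Least)
  then show ?thesis
    using that[of k] m k by simp
qed

lemma funpow_nonzero_mono:
  assumes "(bracket x ^^ n) y \<noteq> 0" "j \<le> n"
  shows "(bracket x ^^ j) y \<noteq> 0"
proof
  assume 0: "(bracket x ^^ j) y = 0"
  have "(bracket x ^^ i) 0 = 0" for i
    by (induction i) auto
  then have "(bracket x ^^ (n - j)) ((bracket x ^^ j) y) = 0"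
    by (simp only: 0)
  moreover have "(bracket x ^^ (n - j)) ((bracket x ^^ j) y) = (bracket x ^^ n) y"
    using assms(2) funpow_add[of "n - j" j "bracket x"] by simp
  ultimately show False
    using assms(1) by simp
qed

definition pairing :: "('e \<Rightarrow> complex) \<Rightarrow> ('e \<Rightarrow> complex) \<Rightarrow> complex"
  where "pairing \<beta> \<alpha> = 2 * \<beta> (dual_vec \<alpha>) / \<alpha> (dual_vec \<alpha>)"

lemma pairing_self: "\<alpha> \<in> nonisotropic_roots \<Longrightarrow> pairing \<alpha> \<alpha> = 2"
  by (simp add: pairing_def nonisotropic_iff)

lemma pairing_add: "pairing (\<beta> + \<gamma>) \<alpha> = pairing \<beta> \<alpha> + pairing \<gamma> \<alpha>"
  by (simp add: pairing_def field_simps add_divide_distrib)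

lemma pairing_uminus: "pairing (- \<beta>) \<alpha> = - pairing \<beta> \<alpha>"
  by (simp add: pairing_def)

lemma pairing_scale_fun: "pairing (scale_fun r \<beta>) \<alpha> = of_real r * pairing \<beta> \<alpha>"
  by (simp add: pairing_def scale_fun_def scaleR_conv_of_real)

lemma pairing_uminus_right:
  "\<beta> \<in> dual \<Longrightarrow> \<alpha> \<in> roots \<Longrightarrow> pairing \<beta> (- \<alpha>) = - pairing \<beta> \<alpha>"
  by (simp add: pairing_def dual_vec_uminus dual_at_uminus dual_vec_in_H roots_dual)

lemma opposite_root_vectorE:
  assumes "\<alpha> \<in> nonisotropic_roots" "e \<in> root_space \<alpha>" "e \<noteq> 0"
  obtains f where "f \<in> root_space (- \<alpha>)" "f \<noteq> 0"
    "\<And>\<beta>. \<beta> \<in> dual \<Longrightarrow> \<beta> (bracket e f) = pairing \<beta> \<alpha>"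
proof -
  have \<alpha>: "\<alpha> \<in> roots" "\<alpha> (dual_vec \<alpha>) \<noteq> 0"
    using assms(1) by (auto simp: nonisotropic_iff)
  obtain f where f: "f \<in> root_space (- \<alpha>)" "form e f = 2 / \<alpha> (dual_vec \<alpha>)"
    using dual_root_vectorE[OF roots_dual[OF \<alpha>(1)] assms(2,3)] .
  have "\<beta> (bracket e f) = pairing \<beta> \<alpha>" if "\<beta> \<in> dual" for \<beta>
    using that by (simp add: bracket_opposite[OF \<alpha>(1) assms(2) f(1)] f(2) pairing_def
        dual_scale dual_vec_in_H[OF \<alpha>(1)])
  moreover have "f \<noteq> 0"
    using f(2) \<alpha>(2) by auto
  ultimately show ?thesis
    using that f(1) by blast
qed

text \<open>
  A nonzero vector killed by \<open>e\<close> generates a finite ladder under the locally nilpotent \<open>f\<close>, and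
  the coefficient in the ladder identity vanishes exactly at its end.
\<close>

lemma highest_weight:
  assumes "\<alpha> \<in> nonisotropic_roots" "f \<in> root_space (- \<alpha>)" "e \<in> root_space \<alpha>"
    and h: "\<And>\<beta>. \<beta> \<in> dual \<Longrightarrow> \<beta> (bracket e f) = pairing \<beta> \<alpha>"
    and w: "w \<in> root_space \<beta>" "\<beta> \<in> dual" "w \<noteq> 0" "bracket e w = 0"
  obtains m :: nat where "pairing \<beta> \<alpha> = of_nat m" "\<And>j. j \<le> m \<Longrightarrow> (bracket f ^^ j) w \<noteq> 0"
proof -
  obtain n where "(bracket f ^^ n) w = 0"
    using ad_locally_nilpotent[OF nonisotropic_uminus[OF assms(1)] assms(2)] by blast
  then obtain k where k: "(bracket f ^^ k) w \<noteq> 0" "bracket f ((bracket f ^^ k) w) = 0"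
    using funpow_last_nonzeroE w(3) by blast
  have "\<alpha> (bracket e f) = 2"
    using h[of \<alpha>] assms(1) by (simp add: pairing_self roots_dual nonisotropic_root)
  then have "scale (of_nat (Suc k) * (pairing \<beta> \<alpha> - of_nat k)) ((bracket f ^^ k) w) = 0"
    using ladder[OF assms(3,2) w(1,4), of k] k(2) by (simp add: h[OF w(2)])
  then have "pairing \<beta> \<alpha> = of_nat k"
    using k(1) by (simp del: of_nat_Suc)
  then show ?thesis
    using that funpow_nonzero_mono[OF k(1)] by blast
qed

text \<open>
  Climb from \<open>E\<^sub>\<beta>\<close> with \<open>e\<close> to a vector of weight \<open>M\<close> killed by \<open>e\<close>, in \<open>k\<close> steps. The ladder down
  from there has \<open>M + 1\<close> nonzero vectors. It passes \<open>E\<^sub>\<beta>\<close> after \<open>k\<close> steps and continues for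
  \<open>M - k \<ge> M - 2 k\<close> more, where \<open>M - 2 k\<close> is the weight of \<open>E\<^sub>\<beta>\<close>.
\<close>

lemma root_string:
  assumes \<alpha>: "\<alpha> \<in> nonisotropic_roots" and \<beta>: "\<beta> \<in> roots"
  obtains m :: int where "pairing \<beta> \<alpha> = of_int m"
    "\<And>j. int j \<le> m \<Longrightarrow> \<beta> - scale_fun (real j) \<alpha> \<in> roots"
proof -
  obtain e where e: "e \<in> root_space \<alpha>" "e \<noteq> 0"
    using root_spaceE[OF nonisotropic_root[OF \<alpha>]] .
  obtain f where f: "f \<in> root_space (- \<alpha>)"
      "\<And>\<beta>. \<beta> \<in> dual \<Longrightarrow> \<beta> (bracket e f) = pairing \<beta> \<alpha>"
    using opposite_root_vectorE[OF \<alpha> e] by blast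
  obtain v where v: "v \<in> root_space \<beta>" "v \<noteq> 0"
    using root_spaceE[OF \<beta>] .
  obtain n where "(bracket e ^^ n) v = 0"
    using ad_locally_nilpotent[OF \<alpha> e(1)] by blast
  then obtain k where k: "(bracket e ^^ k) v \<noteq> 0" "bracket e ((bracket e ^^ k) v) = 0"
    using funpow_last_nonzeroE v(2) by blast
  define w \<gamma> where "w = (bracket e ^^ k) v" and "\<gamma> = \<beta> + scale_fun (real k) \<alpha>"
  have w: "w \<in> root_space \<gamma>" "\<gamma> \<in> dual"
    using funpow_root_space[OF e(1) v(1)] roots_dual[OF \<beta>] roots_dual[OF nonisotropic_root[OF \<alpha>]]
    by (simp_all add: w_def \<gamma>_def dual_add dual_scale_fun)
  obtain M :: nat where M: "pairing \<gamma> \<alpha> = of_nat M" "\<And>j. j \<le> M \<Longrightarrow> (bracket f ^^ j) w \<noteq> 0"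
    using highest_weight[OF \<alpha> f(1) e(1) f(2) w] k by (auto simp: w_def)
  show ?thesis
  proof (rule that)
    show "pairing \<beta> \<alpha> = of_int (int M - 2 * int k)"
      using M(1) pairing_self[OF \<alpha>] by (simp add: \<gamma>_def pairing_add pairing_scale_fun algebra_simps)
    fix j assume "int j \<le> int M - 2 * int k"
    then have "(bracket f ^^ (k + j)) w \<noteq> 0"
      by (intro M(2)) simp
    moreover have "(bracket f ^^ (k + j)) w \<in> root_space (\<gamma> + scale_fun (real (k + j)) (- \<alpha>))"
      by (rule funpow_root_space[OF f(1) w(1)])
    moreover have "\<gamma> + scale_fun (real (k + j)) (- \<alpha>) = \<beta> - scale_fun (real j) \<alpha>"
      by (simp add: \<gamma>_def fun_eq_iff scale_fun_def scaleR_conv_of_real algebra_simps)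
    ultimately show "\<beta> - scale_fun (real j) \<alpha> \<in> roots"
      using roots_dual[OF \<beta>] roots_dual[OF nonisotropic_root[OF \<alpha>]]
      by (intro rootI) (auto intro!: dual_diff dual_scale_fun)
  qed
qed

text \<open>
  A vector killed by a root vector of \<open>\<alpha>\<close> has a non-negative weight.
\<close>

lemma bracket_nonzero:
  assumes \<alpha>: "\<alpha> \<in> nonisotropic_roots" and "\<beta> \<in> dual" "Re (pairing \<beta> \<alpha>) < 0"
    and x: "x \<in> root_space \<alpha>" "x \<noteq> 0" and y: "y \<in> root_space \<beta>" "y \<noteq> 0"
  shows "bracket x y \<noteq> 0"
proof
  assume 0: "bracket x y = 0"
  obtain f where f: "f \<in> root_space (- \<alpha>)"
      "\<And>\<beta>. \<beta> \<in> dual \<Longrightarrow> \<beta> (bracket x f) = pairing \<beta> \<alpha>"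
    using opposite_root_vectorE[OF \<alpha> x] by blast
  obtain m :: nat where "pairing \<beta> \<alpha> = of_nat m"
    using highest_weight[OF \<alpha> f(1) x(1) f(2) y(1) assms(2) y(2) 0] by blast
  then show False
    using assms(3) by simp
qed

lemma root_add:
  assumes "\<alpha> \<in> nonisotropic_roots" "\<beta> \<in> roots" "Re (pairing \<beta> \<alpha>) < 0"
  shows "\<beta> + \<alpha> \<in> roots"
proof -
  obtain x y where "x \<in> root_space \<alpha>" "x \<noteq> 0" "y \<in> root_space \<beta>" "y \<noteq> 0"
    using root_spaceE assms(2) nonisotropic_root[OF assms(1)] by metis
  then have "bracket x y \<noteq> 0" "bracket x y \<in> root_space (\<alpha> + \<beta>)"
    using bracket_nonzero[OF assms(1) roots_dual[OF assms(2)] assms(3)] bracket_root_space by auto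
  then have "\<alpha> + \<beta> \<in> roots"
    using assms roots_dual nonisotropic_root dual_add rootI by metis
  then show ?thesis
    by (simp add: add.commute)
qed

text \<open>
  A vector of \<open>E\<^sub>\<alpha>\<close> orthogonal to some nonzero \<open>f \<in> E\<^sub>-\<^sub>\<alpha>\<close> commutes with \<open>f\<close>, although \<open>f\<close> is
  injective on the positive weight space \<open>E\<^sub>\<alpha>\<close>.
\<close>

lemma nonisotropic_root_space_dim_1:
  assumes \<alpha>: "\<alpha> \<in> nonisotropic_roots" and e: "e \<in> root_space \<alpha>" "e \<noteq> 0" and x: "x \<in> root_space \<alpha>"
  obtains c where "x = scale c e"
proof -
  have d: "\<alpha> \<in> dual"
    using \<alpha> by (simp add: nonisotropic_root roots_dual)
  obtain f where f: "f \<in> root_space (- \<alpha>)" "form e f = 1"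
    using dual_root_vectorE[OF d e] .
  define y where "y = x - scale (form x f) e"
  have y: "y \<in> root_space \<alpha>"
    using x e(1) by (auto simp: y_def intro!: root_space_diff root_space_scale)
  have "bracket y f = 0"
    using bracket_opposite[OF nonisotropic_root[OF \<alpha>] y f(1)] f(2)
    by (simp add: y_def form_diff_left form_scale_left)
  then have "bracket f y = 0"
    using bracket_skew[of f y] by simp
  moreover have "Re (pairing \<alpha> (- \<alpha>)) < 0"
    using \<alpha> by (simp add: pairing_uminus_right d nonisotropic_root pairing_self)
  moreover have "f \<noteq> 0"
    using f(2) by auto
  ultimately have "y = 0"
    using bracket_nonzero[OF nonisotropic_uminus[OF \<alpha>] d _ f(1) _ y] by blast
  then show ?thesis
    using that by (simp add: y_def)
qed

text \<open>
  Suppose that \<open>c = (\<alpha>, \<sigma>) \<noteq> 0\<close>. The Heisenberg algebra attached to \<open>\<sigma>\<close> then yields roots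
  \<open>\<alpha> + n \<sigma>\<close> for infinitely many \<open>n\<close>, whose squared lengths \<open>(\<alpha>, \<alpha>) + 2 n c\<close> are unbounded, while
  integrality of \<open>2 (\<sigma>, \<beta>) / (\<beta>, \<beta>) = 2 c / (\<beta>, \<beta>)\<close> bounds them by \<open>2 \<bar>c\<bar>\<close>.
\<close>

lemma isotropic_orthogonal:
  assumes \<sigma>: "\<sigma> \<in> isotropic_roots" and \<alpha>: "\<alpha> \<in> roots"
  shows "\<alpha> (dual_vec \<sigma>) = 0"
proof (rule ccontr)
  define a c where "a = \<alpha> (dual_vec \<alpha>)" and "c = \<alpha> (dual_vec \<sigma>)"
  assume "\<alpha> (dual_vec \<sigma>) \<noteq> 0"
  then have c: "c \<noteq> 0" by (simp add: c_def)
  have \<sigma>': "\<sigma> \<in> roots" "\<sigma> (dual_vec \<sigma>) = 0" "\<sigma> \<in> dual" "\<alpha> \<in> dual"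
    using \<sigma> \<alpha> by (auto simp: isotropic_iff roots_dual)
  \<comment> \<open>beyond the bound \<open>1 + \<bar>a\<bar> / (2 \<bar>c\<bar>)\<close> that integrality imposes on \<open>\<bar>n\<bar>\<close>\<close>
  define N where "N = nat \<lceil>2 + cmod a / (2 * cmod c)\<rceil>"
  obtain x where x: "x \<in> root_space \<sigma>" "x \<noteq> 0"
    using root_spaceE[OF \<sigma>'(1)] .
  obtain y where y: "y \<in> root_space (- \<sigma>)" "form x y = 1"
    using dual_root_vectorE[OF \<sigma>'(3) x] .
  have h: "bracket x y = dual_vec \<sigma>"
    using bracket_opposite[OF \<sigma>'(1) x(1) y(1)] y(2) by simp
  obtain v where v: "v \<in> root_space \<alpha>" "v \<noteq> 0"
    using root_spaceE[OF \<alpha>] .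
  have "\<exists>n::int. \<bar>n\<bar> = int N \<and> \<alpha> + scale_fun (of_int n) \<sigma> \<in> roots"
  proof (cases "(bracket x ^^ N) v = 0")
    case False
    then have "\<alpha> + scale_fun (real N) \<sigma> \<in> roots"
      using funpow_root_space[OF x(1) v(1)] \<sigma>'
      by (intro rootI[where x = "(bracket x ^^ N) v"]) (auto intro!: dual_add dual_scale_fun)
    then show ?thesis
      by (intro exI[of _ "int N"]) simp
  next
    case True
    then obtain k where k: "(bracket x ^^ k) v \<noteq> 0" "bracket x ((bracket x ^^ k) v) = 0"
      using funpow_last_nonzeroE v(2) by blast
    define w \<beta> where "w = (bracket x ^^ k) v" and "\<beta> = \<alpha> + scale_fun (real k) \<sigma>"
    have w: "w \<in> root_space \<beta>" "bracket x w = 0" "w \<noteq> 0"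
      using funpow_root_space[OF x(1) v(1)] k by (simp_all add: w_def \<beta>_def)
    have \<beta>h: "\<beta> (dual_vec \<sigma>) = c"
      by (simp add: \<beta>_def scale_fun_def \<sigma>' c_def)
    have nz: "(bracket y ^^ j) w \<noteq> 0" for j
    proof (induction j)
      case (Suc j)
      then have "bracket x ((bracket y ^^ Suc j) w) \<noteq> 0"
        unfolding ladder[OF x(1) y(1) w(1,2)] h \<beta>h using c by (simp add: \<sigma>' del: of_nat_Suc)
      then show ?case
        by auto
    qed (simp add: w)
    have "(bracket y ^^ (k + N)) w \<in> root_space (\<beta> + scale_fun (real (k + N)) (- \<sigma>))"
      by (rule funpow_root_space[OF y(1) w(1)])
    moreover have "\<beta> + scale_fun (real (k + N)) (- \<sigma>) = \<alpha> + scale_fun (of_int (- int N)) \<sigma>"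
      by (simp add: \<beta>_def fun_eq_iff scale_fun_def scaleR_conv_of_real algebra_simps)
    ultimately have "\<alpha> + scale_fun (of_int (- int N)) \<sigma> \<in> roots"
      using nz[of "k + N"] \<sigma>' by (intro rootI) (auto intro!: dual_diff dual_scale_fun)
    then show ?thesis
      by (intro exI[of _ "- int N"]) simp
  qed
  then obtain n :: int where n: "\<bar>n\<bar> = int N" "\<alpha> + scale_fun (of_int n) \<sigma> \<in> roots"
    by blast
  define \<beta> where "\<beta> = \<alpha> + scale_fun (of_int n) \<sigma>"
  have \<beta>: "\<beta> \<in> roots"
    using n(2) by (simp add: \<beta>_def)
  have \<sigma>\<beta>: "\<sigma> (dual_vec \<beta>) = c"
    unfolding dual_vec_commute[OF \<sigma>'(1) \<beta>] by (simp add: \<beta>_def scale_fun_def \<sigma>' c_def)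
  have \<alpha>\<beta>: "\<alpha> (dual_vec \<beta>) = a + of_int n * c"
    unfolding dual_vec_commute[OF \<alpha> \<beta>]
    by (simp add: \<beta>_def scale_fun_def scaleR_conv_of_real a_def c_def dual_vec_commute[OF \<alpha> \<sigma>'(1)])
  have \<beta>\<beta>: "\<beta> (dual_vec \<beta>) = a + 2 * of_int n * c"
    using \<sigma>\<beta> \<alpha>\<beta> by (subst \<beta>_def) (simp add: scale_fun_def scaleR_conv_of_real algebra_simps)
  have "cmod (a + 2 * of_int n * c) \<le> 2 * cmod c"
  proof (cases "\<beta> (dual_vec \<beta>) = 0")
    case False
    then have "\<beta> \<in> nonisotropic_roots"
      using \<beta> by (simp add: nonisotropic_iff)
    then obtain m :: int where "pairing \<sigma> \<beta> = of_int m"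
      using root_string \<sigma>'(1) by blast
    then have m: "2 * c = of_int m * (a + 2 * of_int n * c)"
      using False by (simp add: pairing_def \<sigma>\<beta> \<beta>\<beta> field_simps)
    with c have "m \<noteq> 0"
      by auto
    then have "1 \<le> \<bar>real_of_int m\<bar>"
      by linarith
    moreover have "2 * cmod c = \<bar>real_of_int m\<bar> * cmod (a + 2 * of_int n * c)"
      using arg_cong[OF m, of cmod] by (simp add: norm_mult)
    ultimately show ?thesis
      using mult_right_mono[of 1 "\<bar>real_of_int m\<bar>" "cmod (a + 2 * of_int n * c)"] by simp
  qed (use \<beta>\<beta> in simp)
  moreover have "cmod (2 * of_int n * c) \<le> cmod (a + 2 * of_int n * c) + cmod a"
    using norm_triangle_ineq4[of "a + 2 * of_int n * c" a] by simp
  moreover have "cmod (2 * of_int n * c) = 2 * real N * cmod c"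
    using n(1) by (simp add: norm_mult flip: of_int_abs)
  ultimately have "2 * real N * cmod c \<le> 2 * cmod c + cmod a"
    by linarith
  then have "real N \<le> 1 + cmod a / (2 * cmod c)"
    using c by (simp add: field_simps)
  moreover have "2 + cmod a / (2 * cmod c) \<le> real N"
    unfolding N_def by (rule real_nat_ceiling_ge)
  ultimately show False
    by simp
qed


lemma isotropic_orthogonal': "\<sigma> \<in> isotropic_roots \<Longrightarrow> \<alpha> \<in> roots \<Longrightarrow> \<sigma> (dual_vec \<alpha>) = 0"
  using isotropic_orthogonal dual_vec_commute[of \<sigma> \<alpha>] by (simp add: isotropic_iff)

lemma nonisotropic_add_isotropic:
  assumes "\<gamma> \<in> nonisotropic_roots" "\<sigma> \<in> isotropic_roots" "\<gamma> + \<sigma> \<in> roots"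
  shows "\<gamma> + \<sigma> \<in> nonisotropic_roots"
proof -
  have \<gamma>: "\<gamma> \<in> roots"
    using assms(1) by (rule nonisotropic_root)
  have "(\<gamma> + \<sigma>) (dual_vec (\<gamma> + \<sigma>)) = \<gamma> (dual_vec (\<gamma> + \<sigma>))"
    using isotropic_orthogonal'[OF assms(2,3)] by simp
  also have "\<dots> = (\<gamma> + \<sigma>) (dual_vec \<gamma>)"
    by (rule dual_vec_commute[OF \<gamma> assms(3)])
  also have "\<dots> = \<gamma> (dual_vec \<gamma>)"
    using isotropic_orthogonal'[OF assms(2) \<gamma>] by simp
  finally show ?thesis
    using assms by (simp add: nonisotropic_iff)
qed

text \<open>
  With \<open>\<gamma> = - \<alpha> - \<beta>\<close>, the integers of \<open>\<beta>\<close> and \<open>\<gamma>\<close> at \<open>\<alpha>\<close> add up to \<open>-2\<close>, so one of them is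
  negative; by invariance, \<open>[E\<^sub>\<alpha>, E\<^sub>\<gamma>] \<noteq> 0\<close> is as good as \<open>[E\<^sub>\<alpha>, E\<^sub>\<beta>] \<noteq> 0\<close>.
\<close>

lemma bracket_nonisotropic_nonzero:
  assumes \<alpha>: "\<alpha> \<in> nonisotropic_roots" and \<beta>: "\<beta> \<in> nonisotropic_roots" and \<alpha>\<beta>: "\<alpha> + \<beta> \<in> roots"
    and x: "x \<in> root_space \<alpha>" "x \<noteq> 0" and y: "y \<in> root_space \<beta>" "y \<noteq> 0"
  shows "bracket x y \<noteq> 0"
proof (cases "Re (pairing \<beta> \<alpha>) < 0")
  case True
  then show ?thesis
    using bracket_nonzero[OF \<alpha> _ _ x y] \<beta> by (simp add: nonisotropic_root roots_dual)
next
  case False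
  define \<gamma> where "\<gamma> = - (\<alpha> + \<beta>)"
  have \<gamma>: "\<gamma> \<in> roots"
    using \<alpha>\<beta> by (simp only: \<gamma>_def roots_uminus)
  have "Re (pairing \<gamma> \<alpha>) < 0"
    using False unfolding \<gamma>_def pairing_uminus pairing_add pairing_self[OF \<alpha>] by simp
  moreover obtain z where z: "z \<in> root_space \<gamma>" "z \<noteq> 0"
    using root_spaceE[OF \<gamma>] .
  ultimately have nz: "bracket x z \<noteq> 0"
    using bracket_nonzero[OF \<alpha> roots_dual[OF \<gamma>] _ x z] by blast
  have "bracket x z \<in> root_space (- \<beta>)"
    using bracket_root_space[OF x(1) z(1)] by (simp add: \<gamma>_def)
  then obtain y' where y': "y' \<in> root_space (- (- \<beta>))" "form (bracket x z) y' = 1"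
    using dual_root_vectorE[OF roots_dual[OF roots_uminus[OF nonisotropic_root[OF \<beta>]]] _ nz] by blast
  then obtain c where "y' = scale c y"
    using nonisotropic_root_space_dim_1[OF \<beta> y, of y'] by auto
  then have "form (bracket z x) y \<noteq> 0"
    using y'(2) bracket_skew[of x z] form_scale_left[of "-1" "bracket z x" y]
    by (auto simp: form_scale_right)
  then have "form z (bracket x y) \<noteq> 0"
    by (simp only: form_invariant) simp
  then show ?thesis
    by auto
qed

section \<open>The core\<close>

lemma span_bracket_closed:
  assumes G: "\<And>a b. a \<in> G \<Longrightarrow> b \<in> G \<Longrightarrow> bracket a b \<in> span G"
    and "x \<in> span G" "y \<in> span G"
  shows "bracket x y \<in> span G"
proof -
  have *: "bracket a y \<in> span G" if "a \<in> G" for a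
    using assms(3)
    by (induction rule: span_induct_alt)
      (auto simp: bracket_add_right bracket_scale_right intro!: span_add span_scale G that span_zero)
  show ?thesis
    using assms(2)
    by (induction rule: span_induct_alt)
      (auto simp: bracket_add_left bracket_scale_left intro!: span_add span_scale * span_zero)
qed

definition nonisotropic_vectors :: "'e set"
  where "nonisotropic_vectors = (\<Union>\<alpha>\<in>nonisotropic_roots. root_space \<alpha>)"

definition isotropic_brackets :: "'e set"
  where "isotropic_brackets = {bracket x y | x y \<alpha> \<beta>. \<alpha> \<in> nonisotropic_roots \<and>
    \<beta> \<in> nonisotropic_roots \<and> \<alpha> + \<beta> \<in> isotropic_roots \<and> x \<in> root_space \<alpha> \<and> y \<in> root_space \<beta>}"

text \<open>
  Two levels of brackets suffice: bracketing with an isotropic root vector sends a non-isotropic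
  root space to a non-isotropic root space or to \<open>0\<close>, as isotropic roots are orthogonal to all
  roots.
\<close>

lemma core_subset_span: "core \<subseteq> span (nonisotropic_vectors \<union> isotropic_brackets)"
  (is "_ \<subseteq> span ?G")
proof -
  have 11: "bracket x y \<in> span ?G" if xy: "x \<in> nonisotropic_vectors" "y \<in> nonisotropic_vectors" for x y
  proof -
    obtain \<alpha> \<beta> where \<alpha>: "\<alpha> \<in> nonisotropic_roots" "x \<in> root_space \<alpha>"
      and \<beta>: "\<beta> \<in> nonisotropic_roots" "y \<in> root_space \<beta>"
      using xy by (auto simp: nonisotropic_vectors_def)
    have xy: "bracket x y \<in> root_space (\<alpha> + \<beta>)"
      by (rule bracket_root_space[OF \<alpha>(2) \<beta>(2)])
    show ?thesis
    proof (cases "bracket x y = 0")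
      case False
      then have "\<alpha> + \<beta> \<in> roots"
        using rootI[OF _ xy] \<alpha>(1) \<beta>(1) by (simp add: dual_add nonisotropic_root roots_dual)
      then consider "\<alpha> + \<beta> \<in> nonisotropic_roots" | "\<alpha> + \<beta> \<in> isotropic_roots"
        by (auto simp: nonisotropic_roots_def)
      then have "bracket x y \<in> ?G"
        using xy \<alpha> \<beta> by cases (auto simp: nonisotropic_vectors_def isotropic_brackets_def)
      then show ?thesis
        by (rule span_base)
    qed (simp add: span_zero)
  qed
  have 01: "bracket s y \<in> nonisotropic_vectors"
    if s: "s \<in> isotropic_brackets" and y: "y \<in> nonisotropic_vectors" for s y
  proof -
    obtain \<sigma> where \<sigma>: "\<sigma> \<in> isotropic_roots" "s \<in> root_space \<sigma>"
      using s bracket_root_space by (auto simp: isotropic_brackets_def)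
    obtain \<gamma> where \<gamma>: "\<gamma> \<in> nonisotropic_roots" "y \<in> root_space \<gamma>"
      using y by (auto simp: nonisotropic_vectors_def)
    have sy: "bracket s y \<in> root_space (\<gamma> + \<sigma>)"
      using bracket_root_space[OF \<sigma>(2) \<gamma>(2)] by (simp add: add.commute)
    show ?thesis
    proof (cases "bracket s y = 0")
      case True
      then show ?thesis
        using \<gamma>(1) by (auto simp: nonisotropic_vectors_def)
    next
      case False
      then have "\<gamma> + \<sigma> \<in> roots"
        using rootI[OF _ sy] \<gamma>(1) \<sigma>(1)
        by (simp add: dual_add nonisotropic_root roots_dual isotropic_iff)
      then show ?thesis
        using nonisotropic_add_isotropic[OF \<gamma>(1) \<sigma>(1)] sy by (auto simp: nonisotropic_vectors_def)
    qed
  qed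
  have 10: "bracket y s \<in> span ?G"
    if "s \<in> isotropic_brackets" "y \<in> nonisotropic_vectors" for s y
    using 01[OF that] bracket_skew[of y s] by (auto intro: span_base span_neg)
  have 00: "bracket s u \<in> span ?G" if s: "s \<in> isotropic_brackets" and u: "u \<in> isotropic_brackets" for s u
  proof -
    obtain z w where zw: "z \<in> nonisotropic_vectors" "w \<in> nonisotropic_vectors" "u = bracket z w"
      using u unfolding isotropic_brackets_def nonisotropic_vectors_def by blast
    then show ?thesis
      unfolding zw(3) bracket_derivation[of s z w] by (intro span_add 11 01 s zw)
  qed
  have "bracket a b \<in> span ?G" if "a \<in> ?G" "b \<in> ?G" for a b
    using that 11 10 00 01 by (blast intro: span_base)
  then have "lie_subalgebra (span ?G)"
    unfolding lie_subalgebra_def using span_bracket_closed by blast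
  then show ?thesis
    unfolding core_def nonisotropic_vectors_def[symmetric]
    by (intro hull_minimal) (auto intro: span_base)
qed

text \<open>
  The part of the core in an isotropic root space is spanned by the brackets of non-isotropic root
  vectors. The form with vectors of the opposite root space serves as the projection.
\<close>

lemma core_isotropic_vanish:
  assumes add: "\<And>x y. T (x + y) = T x + T y" and sc: "\<And>c x. T (scale c x) = scale c (T x)"
    and T: "\<And>\<alpha> x. x \<in> root_space \<alpha> \<Longrightarrow> T x \<in> root_space \<alpha>"
    and van: "\<And>\<alpha> \<beta> x y. \<alpha> \<in> nonisotropic_roots \<Longrightarrow> \<beta> \<in> nonisotropic_roots \<Longrightarrow> \<alpha> + \<beta> = \<sigma> \<Longrightarrow>
      x \<in> root_space \<alpha> \<Longrightarrow> y \<in> root_space \<beta> \<Longrightarrow> T (bracket x y) = 0"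
    and \<sigma>: "\<sigma> \<in> isotropic_roots" and z: "z \<in> core" "z \<in> root_space \<sigma>"
  shows "T z = 0"
proof (rule root_space_eq_0I[of \<sigma>])
  have d: "\<sigma> \<in> dual"
    using \<sigma> by (simp add: isotropic_iff roots_dual)
  then show "\<sigma> \<in> dual" .
  show "T z \<in> root_space \<sigma>"
    by (rule T[OF z(2)])
  fix y assume y: "y \<in> root_space (- \<sigma>)"
  have other: "form (T u) y = 0" if "u \<in> root_space \<gamma>" "\<gamma> \<in> dual" "\<gamma> \<noteq> \<sigma>" for u \<gamma>
    using form_root_spaces_orthogonal[OF that(2) dual_uminus[OF d] T[OF that(1)] y] that(3) by auto
  have T0: "T 0 = 0"
    using add[of 0 0] by simp
  have "z \<in> span (nonisotropic_vectors \<union> isotropic_brackets)"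
    using z(1) core_subset_span by blast
  then show "form (T z) y = 0"
  proof (induction rule: span_induct_alt)
    case (step c u w)
    have "form (T u) y = 0"
      using step(1)
    proof
      assume "u \<in> nonisotropic_vectors"
      then obtain \<gamma> where "\<gamma> \<in> nonisotropic_roots" "u \<in> root_space \<gamma>"
        by (auto simp: nonisotropic_vectors_def)
      then show ?thesis
        using \<sigma> other[of u \<gamma>] by (auto simp: nonisotropic_roots_def roots_dual)
    next
      assume "u \<in> isotropic_brackets"
      then obtain \<alpha> \<beta> a b where u: "\<alpha> \<in> nonisotropic_roots" "\<beta> \<in> nonisotropic_roots"
          "\<alpha> + \<beta> \<in> isotropic_roots" "u = bracket a b" "a \<in> root_space \<alpha>" "b \<in> root_space \<beta>"
        by (auto simp: isotropic_brackets_def)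
      show ?thesis
      proof (cases "\<alpha> + \<beta> = \<sigma>")
        case True
        then show ?thesis
          using van u by simp
      next
        case False
        then show ?thesis
          using other[of u "\<alpha> + \<beta>"] u bracket_root_space[of a \<alpha> b \<beta>]
          by (simp add: isotropic_iff roots_dual)
      qed
    qed
    with step show ?case
      by (simp add: add sc form_add_left form_scale_left)
  qed (simp add: T0)
qed

lemma centralizer_coreI:
  assumes "\<And>\<alpha> u. \<alpha> \<in> nonisotropic_roots \<Longrightarrow> u \<in> root_space \<alpha> \<Longrightarrow> bracket z u = 0"
  shows "z \<in> core"
proof -
  have "lie_subalgebra {u. bracket z u = 0}"
    unfolding lie_subalgebra_def
    by (auto intro!: subspaceI simp: bracket_add_right bracket_scale_right bracket_derivation[of z])
  then have "core \<subseteq> {u. bracket z u = 0}"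
    unfolding core_def using assms by (intro hull_minimal) auto
  then have "z \<in> centralizer core"
    by (auto simp: centralizer_def)
  then show ?thesis
    using tame by blast
qed

text \<open>
  Otherwise \<open>E\<^sub>\<sigma>\<close> centralizes the core and hence lies in it. But the part of the core in \<open>E\<^sub>\<sigma>\<close> is
  spanned by the brackets \<open>[E\<^sub>\<alpha>, E\<^sub>\<beta>]\<close> with \<open>\<alpha> + \<beta> = \<sigma>\<close>, and then \<open>- \<alpha> + \<sigma> = \<beta>\<close> is a non-isotropic root.
\<close>

lemma isotropic_root_shift:
  assumes \<sigma>: "\<sigma> \<in> isotropic_roots"
  obtains \<alpha> where "\<alpha> \<in> nonisotropic_roots" "\<alpha> + \<sigma> \<in> nonisotropic_roots"
proof -
  have \<sigma>r: "\<sigma> \<in> roots"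
    using \<sigma> by (simp add: isotropic_iff)
  obtain x where x: "x \<in> root_space \<sigma>" "x \<noteq> 0"
    using root_spaceE[OF \<sigma>r] .
  have "\<exists>\<alpha>\<in>nonisotropic_roots. \<alpha> + \<sigma> \<in> nonisotropic_roots"
  proof (rule ccontr)
    assume none: "\<not> ?thesis"
    have "x \<in> core"
    proof (rule centralizer_coreI)
      fix \<alpha> u assume \<alpha>: "\<alpha> \<in> nonisotropic_roots" and u: "u \<in> root_space \<alpha>"
      have "\<alpha> + \<sigma> \<notin> roots"
        using none nonisotropic_add_isotropic[OF \<alpha> \<sigma>] \<alpha> by blast
      then show "bracket x u = 0"
        using rootI[OF _ bracket_root_space[OF x(1) u]] \<alpha> \<sigma>r
        by (auto simp: add.commute[of \<sigma>] dual_add roots_dual nonisotropic_root)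
    qed
    moreover have "\<alpha> + \<beta> \<noteq> \<sigma>" if "\<alpha> \<in> nonisotropic_roots" "\<beta> \<in> nonisotropic_roots" for \<alpha> \<beta>
      using none nonisotropic_uminus[OF that(1)] that(2) by (metis add.assoc add.left_inverse add_0)
    ultimately have "x = 0"
      using core_isotropic_vanish[of "\<lambda>x. x", OF _ _ _ _ \<sigma> _ x(1)] by blast
    then show False
      using x(2) by simp
  qed
  then show ?thesis
    using that by blast
qed

end


section \<open>Obtuse pairs and hubs\<close>

text \<open>
  A combinatorial sufficient condition for an obtuse angle: the string of \<open>b\<close> in direction \<open>a\<close> reaches
  farther to the right than to the left. A single step, \<open>k = 1\<close>, is enough for types C and F; for a
  pair of short roots of \<open>G\<^sub>2\<close> at an angle of 120 degrees, both \<open>b + a\<close> and \<open>b - a\<close> are roots.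
\<close>

definition obtuse :: "(nat \<Rightarrow> real) set \<Rightarrow> (nat \<Rightarrow> real) \<Rightarrow> (nat \<Rightarrow> real) \<Rightarrow> bool"
  where "obtuse \<Phi> b a \<longleftrightarrow> (\<exists>k::nat. k > 0 \<and>
    b + scale_fun (real k) a \<in> insert 0 \<Phi> \<and> b - scale_fun (real k) a \<notin> insert 0 \<Phi>)"

definition obtuse_step :: "(nat \<Rightarrow> real) set \<Rightarrow> ((nat \<Rightarrow> real) \<times> (nat \<Rightarrow> real)) set"
  where "obtuse_step \<Phi> = {(a, a + c) | a c. a \<in> \<Phi> \<and> c \<in> \<Phi> \<and> a + c \<in> \<Phi> \<and> obtuse \<Phi> a c}"

text \<open>
  If \<open>a\<close> and \<open>c\<close> span a subsystem of type \<open>A\<^sub>2\<close> and are at an angle of 120 degrees, so are the pairs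
  \<open>a\<close>, \<open>- c - a\<close> and \<open>a + c\<close>, \<open>- c\<close>. The last clause asks that all three be obtuse in the sense above.
\<close>

definition is_hub :: "(nat \<Rightarrow> real) set \<Rightarrow> (nat \<Rightarrow> real) \<Rightarrow> bool"
  where "is_hub \<Phi> a \<longleftrightarrow> a \<in> \<Phi> \<and> (\<forall>b\<in>\<Phi>. (b, a) \<in> (obtuse_step \<Phi>)\<^sup>*) \<and>
    (\<exists>c\<in>\<Phi>. a + c \<in> \<Phi> \<and> obtuse \<Phi> a c \<and> obtuse \<Phi> a (- c - a) \<and> obtuse \<Phi> (a + c) (- c))"

text \<open>
  The map \<open>bar\<close> is the projection to the quotient by the isotropic span, followed by an isomorphism
  of the quotient onto the span of \<open>\<Phi>\<close>.
\<close>

locale eala_with_quotient_map = extended_affine_lie_algebra scale bracket form H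
  for scale :: "complex \<Rightarrow> 'e::ab_group_add \<Rightarrow> 'e"
    and bracket :: "'e \<Rightarrow> 'e \<Rightarrow> 'e"
    and form :: "'e \<Rightarrow> 'e \<Rightarrow> complex"
    and H :: "'e set" +
  fixes \<Phi> :: "(nat \<Rightarrow> real) set"
    and bar :: "('e \<Rightarrow> complex) \<Rightarrow> nat \<Rightarrow> real"
  assumes bar_add: "u \<in> root_real_span \<Longrightarrow> v \<in> root_real_span \<Longrightarrow> bar (u + v) = bar u + bar v"
    and bar_scale: "u \<in> root_real_span \<Longrightarrow> bar (scale_fun r u) = scale_fun r (bar u)"
    and bar_roots: "bar ` roots = insert 0 \<Phi>"
    and bar_eq_0_imp: "u \<in> root_real_span \<Longrightarrow> bar u = 0 \<Longrightarrow> u \<in> isotropic_real_span"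
    and bar_isotropic: "\<sigma> \<in> isotropic_roots \<Longrightarrow> bar \<sigma> = 0"
    and zero_notin_\<Phi>: "0 \<notin> \<Phi>"
begin

lemma root_in_span: "\<alpha> \<in> roots \<Longrightarrow> \<alpha> \<in> root_real_span"
  by (simp add: root_real_span_def real_fun.span_base)

lemma root_real_span_add: "u \<in> root_real_span \<Longrightarrow> v \<in> root_real_span \<Longrightarrow> u + v \<in> root_real_span"
  and root_real_span_scale: "u \<in> root_real_span \<Longrightarrow> scale_fun r u \<in> root_real_span"
  by (simp_all add: root_real_span_def real_fun.span_add real_fun.span_scale)

lemma uminus_conv_scale_fun: "- (f :: 'i \<Rightarrow> 'v::real_vector) = scale_fun (-1) f"
  by (simp add: scale_fun_def fun_eq_iff)

lemma bar_uminus: "u \<in> root_real_span \<Longrightarrow> bar (- u) = - bar u"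
  by (simp only: uminus_conv_scale_fun bar_scale)

lemma bar_diff: "u \<in> root_real_span \<Longrightarrow> v \<in> root_real_span \<Longrightarrow> bar (u - v) = bar u - bar v"
  using bar_add[of u "- v"] bar_uminus[of v] by (simp add: root_real_span_def real_fun.span_neg)

lemma isotropic_span_orthogonal:
  assumes "v \<in> isotropic_real_span" "\<alpha> \<in> roots"
  shows "v (dual_vec \<alpha>) = 0"
  using assms(1) unfolding isotropic_real_span_def
  by (induction rule: real_fun.span_induct_alt)
    (simp_all add: scale_fun_def isotropic_orthogonal'[OF _ assms(2)])

lemma nonisotropic_iff_bar: "\<alpha> \<in> nonisotropic_roots \<longleftrightarrow> \<alpha> \<in> roots \<and> bar \<alpha> \<in> \<Phi>"
proof safe
  assume \<alpha>: "\<alpha> \<in> nonisotropic_roots"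
  then show r: "\<alpha> \<in> roots"
    by (rule nonisotropic_root)
  have "bar \<alpha> \<noteq> 0"
    using \<alpha> isotropic_span_orthogonal[OF bar_eq_0_imp[OF root_in_span[OF r]] r]
    by (auto simp: nonisotropic_iff)
  then show "bar \<alpha> \<in> \<Phi>"
    using bar_roots r by blast
next
  assume "\<alpha> \<in> roots" "bar \<alpha> \<in> \<Phi>"
  then show "\<alpha> \<in> nonisotropic_roots"
    using bar_isotropic[of \<alpha>] zero_notin_\<Phi> by (auto simp: nonisotropic_roots_def)
qed

lemma liftE:
  assumes "a \<in> \<Phi>"
  obtains \<alpha> where "\<alpha> \<in> nonisotropic_roots" "bar \<alpha> = a"
proof -
  obtain \<alpha> where "\<alpha> \<in> roots" "bar \<alpha> = a"
    using assms bar_roots by (metis imageE insertI2)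
  then show ?thesis
    using that assms by (simp add: nonisotropic_iff_bar)
qed

lemma pairing_cong_bar:
  assumes "u \<in> root_real_span" "v \<in> root_real_span" "bar u = bar v" "\<alpha> \<in> roots"
  shows "pairing u \<alpha> = pairing v \<alpha>"
proof -
  have "u - v \<in> root_real_span"
    using assms(1,2) by (simp add: root_real_span_def real_fun.span_diff)
  then have "(u - v) (dual_vec \<alpha>) = 0"
    using assms bar_diff[of u v] isotropic_span_orthogonal[OF bar_eq_0_imp[of "u - v"]] by simp
  then show ?thesis
    by (simp add: pairing_def)
qed

text \<open>
  The pairing depends on the images in the quotient only, and a root \<open>\<rho>\<close> above \<open>b + k a\<close> has a
  string in direction \<open>- \<alpha>\<close> of length \<open>n + 2 k\<close>, where \<open>n\<close> is the integer of \<open>\<beta>\<close> at \<open>\<alpha>\<close>. If \<open>n\<close> were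
  non-negative, this string would reach a root above \<open>b - k a\<close>. So the sign of \<open>n\<close> can be read off
  from \<open>\<Phi>\<close> without comparing the form of the algebra with the Euclidean one.
\<close>

lemma obtuse_pairing:
  assumes \<alpha>: "\<alpha> \<in> nonisotropic_roots" and \<beta>: "\<beta> \<in> roots" and ob: "obtuse \<Phi> (bar \<beta>) (bar \<alpha>)"
  shows "Re (pairing \<beta> \<alpha>) < 0"
proof (rule ccontr)
  assume "\<not> ?thesis"
  then have n: "0 \<le> Re (pairing \<beta> \<alpha>)"
    by simp
  note [simp] = root_in_span root_real_span_add root_real_span_scale
  have \<alpha>r: "\<alpha> \<in> roots"
    using \<alpha> by (rule nonisotropic_root)
  obtain k :: nat where k: "bar \<beta> + scale_fun (real k) (bar \<alpha>) \<in> insert 0 \<Phi>"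
      "bar \<beta> - scale_fun (real k) (bar \<alpha>) \<notin> insert 0 \<Phi>"
    using ob by (auto simp: obtuse_def)
  obtain \<rho> where \<rho>: "\<rho> \<in> roots" "bar \<rho> = bar \<beta> + scale_fun (real k) (bar \<alpha>)"
    using k(1) bar_roots by (metis imageE)
  have "pairing \<rho> \<alpha> = pairing (\<beta> + scale_fun (real k) \<alpha>) \<alpha>"
    using \<rho> \<alpha>r \<beta> by (intro pairing_cong_bar) (simp_all add: bar_add bar_scale)
  then have p: "pairing \<rho> \<alpha> = pairing \<beta> \<alpha> + 2 * of_nat k"
    by (simp add: pairing_add pairing_scale_fun pairing_self[OF \<alpha>])
  obtain m :: int where m: "pairing \<rho> \<alpha> = of_int m"
      "\<And>j. int j \<le> m \<Longrightarrow> \<rho> - scale_fun (real j) \<alpha> \<in> roots"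
    using root_string[OF \<alpha> \<rho>(1)] by blast
  have "real (2 * k) \<le> real_of_int m"
    using n arg_cong[OF m(1), of Re] arg_cong[OF p, of Re] by simp
  then have "\<rho> - scale_fun (real (2 * k)) \<alpha> \<in> roots"
    by (intro m(2)) linarith
  then have "bar (\<rho> - scale_fun (real (2 * k)) \<alpha>) \<in> insert 0 \<Phi>"
    using bar_roots by blast
  moreover have "bar (\<rho> - scale_fun (real (2 * k)) \<alpha>) = bar \<rho> - scale_fun (real (2 * k)) (bar \<alpha>)"
    using \<rho>(1) \<alpha>r by (simp add: bar_diff bar_scale)
  moreover have "\<dots> = bar \<beta> - scale_fun (real k) (bar \<alpha>)"
    by (simp add: \<rho>(2) fun_eq_iff scale_fun_def)
  ultimately show False
    using k(2) by simp
qed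

lemma obtuse_root_add:
  assumes "\<beta> \<in> roots" "\<alpha> \<in> nonisotropic_roots" "obtuse \<Phi> (bar \<beta>) (bar \<alpha>)"
  shows "\<beta> + \<alpha> \<in> roots" "bar (\<beta> + \<alpha>) = bar \<beta> + bar \<alpha>"
  using root_add[OF assms(2,1) obtuse_pairing[OF assms(2,1,3)]] assms
  by (simp_all add: bar_add root_in_span nonisotropic_root)

end

lemma (in extended_affine_lie_algebra) has_type_quotient_mapE:
  assumes "has_type \<Phi>" "0 \<notin> \<Phi>"
  obtains bar where "eala_with_quotient_map scale bracket form H \<Phi> bar"
proof -
  obtain g where inj: "inj_on g (quot_class ` root_real_span)"
    and add: "\<And>u v. u \<in> root_real_span \<Longrightarrow> v \<in> root_real_span \<Longrightarrow>
         g (quot_class (u + v)) = g (quot_class u) + g (quot_class v)"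
    and sc: "\<And>r v. v \<in> root_real_span \<Longrightarrow>
         g (quot_class (scale_fun r v)) = scale_fun r (g (quot_class v))"
    and im: "g ` quot_roots = insert 0 \<Phi>"
    using assms(1) by (auto simp: has_type_def bij_betw_def)
  have 0: "0 \<in> root_real_span"
    by (simp add: root_real_span_def real_fun.span_zero)
  then have g0: "g (quot_class 0) = 0"
    using add[of 0 0] by simp
  have "eala_with_quotient_map scale bracket form H \<Phi> (\<lambda>u. g (quot_class u))"
  proof
    show "(\<lambda>u. g (quot_class u)) ` roots = insert 0 \<Phi>"
      using im by (simp add: quot_roots_def image_image)
    fix u assume "u \<in> root_real_span" "g (quot_class u) = 0"
    then have "quot_class u = quot_class 0"
      using inj_onD[OF inj, of "quot_class u" "quot_class 0"] 0 g0 by simp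
    moreover have "u \<in> quot_class u"
      unfolding quot_class_def isotropic_real_span_def
      by (rule CollectI, rule exI[of _ 0]) (simp add: real_fun.span_zero)
    ultimately show "u \<in> isotropic_real_span"
      by (auto simp: quot_class_def)
  next
    fix \<sigma> assume "\<sigma> \<in> isotropic_roots"
    then have \<sigma>: "\<sigma> \<in> isotropic_real_span"
      by (simp add: isotropic_real_span_def real_fun.span_base)
    have "quot_class \<sigma> = quot_class 0"
    proof (intro set_eqI iffI)
      fix v assume "v \<in> quot_class \<sigma>"
      then show "v \<in> quot_class 0"
        using \<sigma> by (auto simp: quot_class_def isotropic_real_span_def intro: real_fun.span_add)
    next
      fix v assume "v \<in> quot_class 0"
      then have "v - \<sigma> \<in> isotropic_real_span" 
        using \<sigma> by (auto simp: quot_class_def isotropic_real_span_def intro: real_fun.span_diff)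
      then show "v \<in> quot_class \<sigma>"
        unfolding quot_class_def by (intro CollectI exI[of _ "v - \<sigma>"]) simp
    qed
    then show "g (quot_class \<sigma>) = 0"
      using g0 by simp
  qed (use add sc assms(2) in simp_all)
  then show ?thesis
    using that by blast
qed

section \<open>Cartan automorphisms\<close>

lemma (in extended_affine_lie_algebra) cartan_automorphism_root_space:
  assumes "cartan_automorphism \<Psi>" "x \<in> root_space \<alpha>"
  shows "\<Psi> x \<in> root_space \<alpha>"
proof -
  have lin: "Vector_Spaces.linear scale scale \<Psi>" and br: "\<And>x y. \<Psi> (bracket x y) = bracket (\<Psi> x) (\<Psi> y)"
    and fix_H: "\<And>h. h \<in> H \<Longrightarrow> \<Psi> h = h"
    using assms(1) by (auto simp: cartan_automorphism_def lie_automorphism_def)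
  interpret Vector_Spaces.linear scale scale \<Psi>
    by (rule lin)
  have "bracket h (\<Psi> x) = scale (\<alpha> h) (\<Psi> x)" if "h \<in> H" for h
    using br[of h x] by (simp add: fix_H[OF that] H_bracket[OF that assms(2)] scale)
  then show ?thesis
    by (simp add: root_space_def)
qed

locale eala_hub_cartan = eala_with_quotient_map scale bracket form H \<Phi> bar
  for scale :: "complex \<Rightarrow> 'e::ab_group_add \<Rightarrow> 'e"
    and bracket :: "'e \<Rightarrow> 'e \<Rightarrow> 'e"
    and form :: "'e \<Rightarrow> 'e \<Rightarrow> complex"
    and H :: "'e set"
    and \<Phi> :: "(nat \<Rightarrow> real) set"
    and bar :: "('e \<Rightarrow> complex) \<Rightarrow> nat \<Rightarrow> real" +
  fixes \<Psi> :: "'e \<Rightarrow> 'e"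
    and hub :: "nat \<Rightarrow> real"
  assumes cartan: "cartan_automorphism \<Psi>"
    and finite_order: "finite_order \<Psi>"
    and hub: "is_hub \<Phi> hub"
begin

abbreviation \<eta> :: "('e \<Rightarrow> complex) \<Rightarrow> complex"
  where "\<eta> \<equiv> root_eigenvalue \<Psi>"

lemma linear_\<Psi>: "Vector_Spaces.linear scale scale \<Psi>"
  and \<Psi>_bracket: "\<Psi> (bracket x y) = bracket (\<Psi> x) (\<Psi> y)"
  and \<Psi>_H: "h \<in> H \<Longrightarrow> \<Psi> h = h"
  and inj_\<Psi>: "inj \<Psi>"
  using cartan by (auto simp: cartan_automorphism_def lie_automorphism_def bij_is_inj)

sublocale \<Psi>: Vector_Spaces.linear scale scale \<Psi>
  by (rule linear_\<Psi>)

lemma \<Psi>_root_space: "x \<in> root_space \<alpha> \<Longrightarrow> \<Psi> x \<in> root_space \<alpha>"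
  using cartan_automorphism_root_space cartan by blast

lemma root_eigenvalue_eqI:
  assumes "\<alpha> \<in> roots" "\<And>x. x \<in> root_space \<alpha> \<Longrightarrow> \<Psi> x = scale c x"
  shows "\<eta> \<alpha> = c"
  unfolding root_eigenvalue_def
proof (rule the_equality)
  show "\<forall>x\<in>root_space \<alpha>. \<Psi> x = scale c x"
    using assms(2) by blast
  fix d assume d: "\<forall>x\<in>root_space \<alpha>. \<Psi> x = scale d x"
  obtain x where "x \<in> root_space \<alpha>" "x \<noteq> 0"
    using root_spaceE[OF assms(1)] .
  then show "d = c"
    using d assms(2)[of x] by (metis scale_right_imp_eq)
qed

lemma \<Psi>_nonisotropic:
  assumes \<alpha>: "\<alpha> \<in> nonisotropic_roots" and x: "x \<in> root_space \<alpha>"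
  shows "\<Psi> x = scale (\<eta> \<alpha>) x"
proof -
  obtain e where e: "e \<in> root_space \<alpha>" "e \<noteq> 0"
    using root_spaceE[OF nonisotropic_root[OF \<alpha>]] .
  obtain c where c: "\<Psi> e = scale c e"
    using nonisotropic_root_space_dim_1[OF \<alpha> e \<Psi>_root_space[OF e(1)]] .
  have all: "\<Psi> y = scale c y" if y: "y \<in> root_space \<alpha>" for y
  proof -
    obtain d where "y = scale d e"
      using nonisotropic_root_space_dim_1[OF \<alpha> e y] .
    then show ?thesis
      by (simp add: \<Psi>.scale c mult.commute)
  qed
  then have "\<eta> \<alpha> = c"
    by (rule root_eigenvalue_eqI[OF nonisotropic_root[OF \<alpha>]])
  then show ?thesis
    using all x by simp
qed

lemma \<eta>_nonzero:
  assumes \<alpha>: "\<alpha> \<in> nonisotropic_roots"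
  shows "\<eta> \<alpha> \<noteq> 0"
proof
  assume 0: "\<eta> \<alpha> = 0"
  obtain e where e: "e \<in> root_space \<alpha>" "e \<noteq> 0"
    using root_spaceE[OF nonisotropic_root[OF \<alpha>]] .
  then have "\<Psi> e = \<Psi> 0"
    using \<Psi>_nonisotropic[OF \<alpha> e(1)] 0 by (simp only: \<Psi>.zero scale_zero_left)
  then show False
    using e(2) injD[OF inj_\<Psi>] by blast
qed

lemma \<Psi>_bracket_nonisotropic:
  assumes "\<alpha> \<in> nonisotropic_roots" "\<beta> \<in> nonisotropic_roots" "x \<in> root_space \<alpha>" "y \<in> root_space \<beta>"
  shows "\<Psi> (bracket x y) = scale (\<eta> \<alpha> * \<eta> \<beta>) (bracket x y)"
  using assms by (simp add: \<Psi>_bracket \<Psi>_nonisotropic bracket_scale_left bracket_scale_right)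

lemma \<eta>_add:
  assumes "\<alpha> \<in> nonisotropic_roots" "\<beta> \<in> nonisotropic_roots" "\<alpha> + \<beta> \<in> nonisotropic_roots"
  shows "\<eta> (\<alpha> + \<beta>) = \<eta> \<alpha> * \<eta> \<beta>"
proof -
  obtain x y where xy: "x \<in> root_space \<alpha>" "x \<noteq> 0" "y \<in> root_space \<beta>" "y \<noteq> 0"
    using root_spaceE nonisotropic_root assms(1,2) by metis
  have "scale (\<eta> (\<alpha> + \<beta>)) (bracket x y) = scale (\<eta> \<alpha> * \<eta> \<beta>) (bracket x y)"
    using \<Psi>_bracket_nonisotropic[OF assms(1,2) xy(1,3)]
      \<Psi>_nonisotropic[OF assms(3) bracket_root_space[OF xy(1,3)]] by simp
  then show ?thesis
    using bracket_nonisotropic_nonzero[OF assms(1,2) nonisotropic_root[OF assms(3)] xy]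
      scale_right_imp_eq by blast
qed

lemma \<eta>_uminus:
  assumes \<alpha>: "\<alpha> \<in> nonisotropic_roots"
  shows "\<eta> (- \<alpha>) = inverse (\<eta> \<alpha>)"
proof -
  have r: "\<alpha> \<in> roots"
    using \<alpha> by (rule nonisotropic_root)
  obtain e where e: "e \<in> root_space \<alpha>" "e \<noteq> 0"
    using root_spaceE[OF r] .
  obtain f where f: "f \<in> root_space (- \<alpha>)" "form e f = 1"
    using dual_root_vectorE[OF roots_dual[OF r] e] .
  have ef: "bracket e f = dual_vec \<alpha>"
    using bracket_opposite[OF r e(1) f(1)] f(2) by simp
  have "dual_vec \<alpha> \<noteq> 0"
    using \<alpha> dual_scale[OF roots_dual[OF r] dual_vec_in_H[OF r], of 0] by (auto simp: nonisotropic_iff)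
  moreover have "scale (\<eta> \<alpha> * \<eta> (- \<alpha>)) (dual_vec \<alpha>) = scale 1 (dual_vec \<alpha>)"
    using \<Psi>_bracket_nonisotropic[OF \<alpha> nonisotropic_uminus[OF \<alpha>] e(1) f(1)]
    by (simp add: ef \<Psi>_H dual_vec_in_H[OF r])
  ultimately have "\<eta> \<alpha> * \<eta> (- \<alpha>) = 1"
    using scale_right_imp_eq by blast
  then show ?thesis
    using \<eta>_nonzero[OF \<alpha>] by (simp add: field_simps)
qed

text \<open>
  Both sums are roots because the two roots have the same integer at \<open>\<gamma>\<close>, and the factor \<open>\<eta>(\<gamma>)\<close>
  cancels.
\<close>

lemma obtuse_shift:
  assumes "\<alpha> \<in> nonisotropic_roots" "\<alpha>' \<in> nonisotropic_roots" "bar \<alpha>' = bar \<alpha>"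
    and \<gamma>: "\<gamma> \<in> nonisotropic_roots" "obtuse \<Phi> (bar \<alpha>) (bar \<gamma>)" "bar \<alpha> + bar \<gamma> \<in> \<Phi>"
  shows "\<alpha> + \<gamma> \<in> nonisotropic_roots" "\<alpha>' + \<gamma> \<in> nonisotropic_roots"
    and "bar (\<alpha> + \<gamma>) = bar \<alpha> + bar \<gamma>" "bar (\<alpha>' + \<gamma>) = bar \<alpha> + bar \<gamma>"
    and "\<eta> (\<alpha>' + \<gamma>) / \<eta> (\<alpha> + \<gamma>) = \<eta> \<alpha>' / \<eta> \<alpha>"
proof -
  show b: "bar (\<alpha> + \<gamma>) = bar \<alpha> + bar \<gamma>" "bar (\<alpha>' + \<gamma>) = bar \<alpha> + bar \<gamma>"
    and n: "\<alpha> + \<gamma> \<in> nonisotropic_roots" "\<alpha>' + \<gamma> \<in> nonisotropic_roots"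
    using obtuse_root_add[of \<alpha> \<gamma>] obtuse_root_add[of \<alpha>' \<gamma>] assms
    by (simp_all add: nonisotropic_iff_bar)
  show "\<eta> (\<alpha>' + \<gamma>) / \<eta> (\<alpha> + \<gamma>) = \<eta> \<alpha>' / \<eta> \<alpha>"
    using \<eta>_nonzero[OF \<gamma>(1)] by (simp add: \<eta>_add assms(1,2) \<gamma>(1) n)
qed

lemma shift_to_hub:
  assumes "\<alpha> \<in> nonisotropic_roots" "\<alpha> + \<sigma> \<in> nonisotropic_roots" "bar (\<alpha> + \<sigma>) = bar \<alpha>"
  obtains \<beta> where "\<beta> \<in> nonisotropic_roots" "\<beta> + \<sigma> \<in> nonisotropic_roots"
    "bar \<beta> = hub" "bar (\<beta> + \<sigma>) = hub" "\<eta> (\<beta> + \<sigma>) / \<eta> \<beta> = \<eta> (\<alpha> + \<sigma>) / \<eta> \<alpha>"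
proof -
  have "(bar \<alpha>, hub) \<in> (obtuse_step \<Phi>)\<^sup>*"
    using hub assms(1) by (simp add: is_hub_def nonisotropic_iff_bar)
  then have "\<exists>\<beta>. \<beta> \<in> nonisotropic_roots \<and> \<beta> + \<sigma> \<in> nonisotropic_roots \<and>
    bar \<beta> = hub \<and> bar (\<beta> + \<sigma>) = hub \<and> \<eta> (\<beta> + \<sigma>) / \<eta> \<beta> = \<eta> (\<alpha> + \<sigma>) / \<eta> \<alpha>"
  proof (induction rule: rtrancl_induct)
    case base
    then show ?case
      using assms by blast
  next
    case (step b b')
    then obtain \<beta> where \<beta>: "\<beta> \<in> nonisotropic_roots" "\<beta> + \<sigma> \<in> nonisotropic_roots"
        "bar \<beta> = b" "bar (\<beta> + \<sigma>) = b" "\<eta> (\<beta> + \<sigma>) / \<eta> \<beta> = \<eta> (\<alpha> + \<sigma>) / \<eta> \<alpha>"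
      by blast
    obtain c where c: "b' = b + c" "c \<in> \<Phi>" "b + c \<in> \<Phi>" "obtuse \<Phi> b c"
      using step(2) by (auto simp: obtuse_step_def)
    obtain \<gamma> where \<gamma>: "\<gamma> \<in> nonisotropic_roots" "bar \<gamma> = c"
      using liftE[OF c(2)] .
    have "(\<beta> + \<gamma>) + \<sigma> = \<beta> + \<sigma> + \<gamma>"
      by (simp add: ac_simps)
    have "\<beta> + \<gamma> \<in> nonisotropic_roots \<and> (\<beta> + \<gamma>) + \<sigma> \<in> nonisotropic_roots \<and>
        bar (\<beta> + \<gamma>) = b' \<and> bar ((\<beta> + \<gamma>) + \<sigma>) = b' \<and>
        \<eta> ((\<beta> + \<gamma>) + \<sigma>) / \<eta> (\<beta> + \<gamma>) = \<eta> (\<alpha> + \<sigma>) / \<eta> \<alpha>"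
      using obtuse_shift[of \<beta> "\<beta> + \<sigma>" \<gamma>] \<beta> \<gamma> c
      unfolding \<open>(\<beta> + \<gamma>) + \<sigma> = \<beta> + \<sigma> + \<gamma>\<close> by simp
    then show ?case
      by blast
  qed
  then show ?thesis
    using that by blast
qed

text \<open>
  Two roots \<open>\<alpha>\<close>, \<open>\<beta>\<close> above the hub \<open>a\<close> differ by an element of the isotropic span that need not be
  a root, so \<open>\<beta>\<close> is reached from \<open>\<alpha>\<close> in two obtuse steps: along a root \<open>\<gamma>\<close> above \<open>c\<close>, then along
  \<open>\<delta> = \<beta> - \<alpha> - \<gamma>\<close>, which is a root because \<open>\<beta>\<close> and \<open>- \<alpha> - \<gamma>\<close> form an obtuse pair.
\<close>

lemma shift_at_hub:
  assumes \<alpha>: "\<alpha> \<in> nonisotropic_roots" "\<alpha> + \<sigma> \<in> nonisotropic_roots" "bar \<alpha> = hub" "bar (\<alpha> + \<sigma>) = hub"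
    and \<beta>: "\<beta> \<in> nonisotropic_roots" "bar \<beta> = hub"
  shows "\<beta> + \<sigma> \<in> nonisotropic_roots" "bar (\<beta> + \<sigma>) = hub" "\<eta> (\<beta> + \<sigma>) / \<eta> \<beta> = \<eta> (\<alpha> + \<sigma>) / \<eta> \<alpha>"
proof -
  obtain c where c: "c \<in> \<Phi>" "hub + c \<in> \<Phi>" "obtuse \<Phi> hub c" "obtuse \<Phi> hub (- c - hub)"
      "obtuse \<Phi> (hub + c) (- c)" and hub_\<Phi>: "hub \<in> \<Phi>"
    using hub by (auto simp: is_hub_def)
  obtain \<gamma> where \<gamma>: "\<gamma> \<in> nonisotropic_roots" "bar \<gamma> = c"
    using liftE[OF c(1)] .
  note step1 = obtuse_shift[of \<alpha> "\<alpha> + \<sigma>" \<gamma>]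
  have 1: "\<alpha> + \<gamma> \<in> nonisotropic_roots" "\<alpha> + \<sigma> + \<gamma> \<in> nonisotropic_roots"
      "bar (\<alpha> + \<gamma>) = hub + c" "bar (\<alpha> + \<sigma> + \<gamma>) = hub + c"
      "\<eta> (\<alpha> + \<sigma> + \<gamma>) / \<eta> (\<alpha> + \<gamma>) = \<eta> (\<alpha> + \<sigma>) / \<eta> \<alpha>"
    using step1 \<alpha> \<gamma> c by simp_all
  define \<delta> where "\<delta> = \<beta> + - (\<alpha> + \<gamma>)"
  have "bar (- (\<alpha> + \<gamma>)) = - c - hub"
    using 1 by (subst bar_uminus) (simp_all add: root_in_span nonisotropic_root del: minus_add_distrib)
  then have \<delta>: "\<delta> \<in> roots" "bar \<delta> = - c"
    unfolding \<delta>_def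
    using obtuse_root_add[of \<beta> "- (\<alpha> + \<gamma>)"] nonisotropic_uminus[OF 1(1)] \<beta> c
    by (simp_all add: nonisotropic_root del: minus_add_distrib)
  have "bar (- \<gamma>) = - c"
    using \<gamma> by (simp add: bar_uminus root_in_span nonisotropic_root)
  then have "- c \<in> \<Phi>"
    using nonisotropic_uminus[OF \<gamma>(1)] by (simp add: nonisotropic_iff_bar)
  with \<delta> have "\<delta> \<in> nonisotropic_roots"
    by (simp add: nonisotropic_iff_bar)
  note step2 = obtuse_shift[of "\<alpha> + \<gamma>" "\<alpha> + \<sigma> + \<gamma>" \<delta>, unfolded 1(3,4) \<delta>(2),
      OF 1(1,2) refl this c(5)]
  have "\<alpha> + \<gamma> + \<delta> = \<beta>" "\<alpha> + \<sigma> + \<gamma> + \<delta> = \<beta> + \<sigma>"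
    by (simp_all add: \<delta>_def algebra_simps)
  with step2 show "\<beta> + \<sigma> \<in> nonisotropic_roots" "bar (\<beta> + \<sigma>) = hub"
    "\<eta> (\<beta> + \<sigma>) / \<eta> \<beta> = \<eta> (\<alpha> + \<sigma>) / \<eta> \<alpha>"
    using hub_\<Phi> 1(5) by simp_all
qed

lemma shift_ratio_unique:
  assumes "\<alpha> \<in> nonisotropic_roots" "\<alpha> + \<sigma> \<in> nonisotropic_roots" "bar (\<alpha> + \<sigma>) = bar \<alpha>"
    and "\<beta> \<in> nonisotropic_roots" "\<beta> + \<sigma> \<in> nonisotropic_roots" "bar (\<beta> + \<sigma>) = bar \<beta>"
  shows "\<eta> (\<beta> + \<sigma>) / \<eta> \<beta> = \<eta> (\<alpha> + \<sigma>) / \<eta> \<alpha>"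
proof -
  obtain \<alpha>1 where \<alpha>1: "\<alpha>1 \<in> nonisotropic_roots" "\<alpha>1 + \<sigma> \<in> nonisotropic_roots"
      "bar \<alpha>1 = hub" "bar (\<alpha>1 + \<sigma>) = hub" "\<eta> (\<alpha>1 + \<sigma>) / \<eta> \<alpha>1 = \<eta> (\<alpha> + \<sigma>) / \<eta> \<alpha>"
    using shift_to_hub[OF assms(1-3)] .
  obtain \<beta>1 where \<beta>1: "\<beta>1 \<in> nonisotropic_roots" "\<beta>1 + \<sigma> \<in> nonisotropic_roots"
      "bar \<beta>1 = hub" "bar (\<beta>1 + \<sigma>) = hub" "\<eta> (\<beta>1 + \<sigma>) / \<eta> \<beta>1 = \<eta> (\<beta> + \<sigma>) / \<eta> \<beta>"
    using shift_to_hub[OF assms(4-6)] .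
  show ?thesis
    using shift_at_hub(3)[OF \<alpha>1(1-4) \<beta>1(1,3)] \<alpha>1(5) \<beta>1(5) by simp
qed

lemma bar_add_isotropic: "\<alpha> \<in> roots \<Longrightarrow> \<sigma> \<in> isotropic_roots \<Longrightarrow> bar (\<alpha> + \<sigma>) = bar \<alpha>"
  by (simp add: bar_add root_in_span isotropic_iff bar_isotropic)

abbreviation \<psi> :: "('e \<Rightarrow> complex) \<Rightarrow> complex"
  where "\<psi> \<equiv> assoc_core_character \<Psi>"

lemma \<psi>_nonisotropic: "\<alpha> \<in> nonisotropic_roots \<Longrightarrow> \<psi> \<alpha> = \<eta> \<alpha>"
  by (simp add: assoc_core_character_def)

lemma \<psi>_isotropic:
  assumes \<sigma>: "\<sigma> \<in> isotropic_roots"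
    and \<alpha>: "\<alpha> \<in> nonisotropic_roots" "\<alpha> + \<sigma> \<in> nonisotropic_roots"
  shows "\<psi> \<sigma> = \<eta> (\<alpha> + \<sigma>) / \<eta> \<alpha>"
proof -
  define \<beta> where "\<beta> = (SOME \<beta>. \<beta> \<in> nonisotropic_roots \<and> \<beta> + \<sigma> \<in> nonisotropic_roots)"
  have \<beta>: "\<beta> \<in> nonisotropic_roots \<and> \<beta> + \<sigma> \<in> nonisotropic_roots"
    unfolding \<beta>_def by (rule someI[of _ \<alpha>]) (use \<alpha> in blast)
  have "\<psi> \<sigma> = \<eta> (\<beta> + \<sigma>) * \<eta> (- \<beta>)"
    using \<sigma> by (simp add: assoc_core_character_def \<beta>_def nonisotropic_roots_def Let_def)
  also have "\<dots> = \<eta> (\<beta> + \<sigma>) / \<eta> \<beta>"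
    using \<beta> by (simp add: \<eta>_uminus divide_inverse)
  also have "\<dots> = \<eta> (\<alpha> + \<sigma>) / \<eta> \<alpha>"
    using \<alpha> \<beta> \<sigma> by (intro shift_ratio_unique) (simp_all add: bar_add_isotropic nonisotropic_root)
  finally show ?thesis .
qed

lemma \<psi>_nonzero:
  assumes "\<alpha> \<in> roots"
  shows "\<psi> \<alpha> \<noteq> 0"
proof (cases "\<alpha> \<in> nonisotropic_roots")
  case True
  then show ?thesis
    by (simp add: \<psi>_nonisotropic \<eta>_nonzero)
next
  case False
  then have \<alpha>: "\<alpha> \<in> isotropic_roots"
    using assms by (simp add: nonisotropic_roots_def)
  obtain \<beta> where "\<beta> \<in> nonisotropic_roots" "\<beta> + \<alpha> \<in> nonisotropic_roots"
    using isotropic_root_shift[OF \<alpha>] .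
  then show ?thesis
    using \<psi>_isotropic[OF \<alpha>] by (simp add: \<eta>_nonzero)
qed

lemma \<psi>_add_isotropic:
  assumes \<alpha>: "\<alpha> \<in> nonisotropic_roots" and \<sigma>: "\<sigma> \<in> isotropic_roots" and sum: "\<alpha> + \<sigma> \<in> roots"
  shows "\<psi> (\<alpha> + \<sigma>) = \<psi> \<alpha> * \<psi> \<sigma>"
  using nonisotropic_add_isotropic[OF assms] \<psi>_isotropic[OF \<sigma> \<alpha>] \<alpha>
  by (simp add: \<psi>_nonisotropic \<eta>_nonzero)

lemma \<psi>_add_nonisotropic:
  assumes \<alpha>: "\<alpha> \<in> nonisotropic_roots" and \<beta>: "\<beta> \<in> nonisotropic_roots" and sum: "\<alpha> + \<beta> \<in> roots"
  shows "\<psi> (\<alpha> + \<beta>) = \<psi> \<alpha> * \<psi> \<beta>"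
proof (cases "\<alpha> + \<beta> \<in> nonisotropic_roots")
  case True
  then show ?thesis
    using \<alpha> \<beta> by (simp add: \<psi>_nonisotropic \<eta>_add)
next
  case False
  then have "\<alpha> + \<beta> \<in> isotropic_roots"
    using sum by (simp add: nonisotropic_roots_def)
  then have "\<psi> (\<alpha> + \<beta>) = \<eta> \<beta> / \<eta> (- \<alpha>)"
    using \<psi>_isotropic[of "\<alpha> + \<beta>" "- \<alpha>"] nonisotropic_uminus[OF \<alpha>] \<beta> by simp
  then show ?thesis
    using \<alpha> \<beta> by (simp add: \<eta>_uminus \<psi>_nonisotropic divide_inverse)
qed

text \<open>
  The root \<open>\<sigma>\<close> can be added to some non-isotropic root; this property moves along obtuse steps to
  some root above the hub and from there to every other one.
\<close>

lemma isotropic_shift_at_hub: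
  assumes \<sigma>: "\<sigma> \<in> isotropic_roots" and \<alpha>: "\<alpha> \<in> nonisotropic_roots" "bar \<alpha> = hub"
  shows "\<alpha> + \<sigma> \<in> nonisotropic_roots" "bar (\<alpha> + \<sigma>) = hub"
proof -
  obtain \<beta> where \<beta>: "\<beta> \<in> nonisotropic_roots" "\<beta> + \<sigma> \<in> nonisotropic_roots"
    using isotropic_root_shift[OF \<sigma>] .
  then obtain \<gamma> where \<gamma>: "\<gamma> \<in> nonisotropic_roots" "\<gamma> + \<sigma> \<in> nonisotropic_roots"
      "bar \<gamma> = hub" "bar (\<gamma> + \<sigma>) = hub"
    using shift_to_hub[OF \<beta>] bar_add_isotropic[OF nonisotropic_root \<sigma>] by metis
  show "\<alpha> + \<sigma> \<in> nonisotropic_roots" "bar (\<alpha> + \<sigma>) = hub"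
    using shift_at_hub[OF \<gamma> \<alpha>] by blast+
qed

text \<open>
  At the hub every isotropic root is an admissible shift, so \<open>\<sigma>\<close> and \<open>\<tau>\<close> can be added one after the
  other to the same root.
\<close>

lemma \<psi>_add_isotropic_isotropic:
  assumes \<sigma>: "\<sigma> \<in> isotropic_roots" and \<tau>: "\<tau> \<in> isotropic_roots" and sum: "\<sigma> + \<tau> \<in> isotropic_roots"
  shows "\<psi> (\<sigma> + \<tau>) = \<psi> \<sigma> * \<psi> \<tau>"
proof -
  have "hub \<in> \<Phi>"
    using hub by (simp add: is_hub_def)
  then obtain \<alpha> where \<alpha>: "\<alpha> \<in> nonisotropic_roots" "bar \<alpha> = hub"
    using liftE by blast
  note \<alpha>\<sigma> = isotropic_shift_at_hub[OF \<sigma> \<alpha>]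
  note \<alpha>\<sigma>\<tau> = isotropic_shift_at_hub[OF \<tau> \<alpha>\<sigma>]
  have "\<psi> (\<sigma> + \<tau>) = \<eta> (\<alpha> + \<sigma> + \<tau>) / \<eta> \<alpha>"
    using \<psi>_isotropic[OF sum \<alpha>(1)] \<alpha>\<sigma>\<tau>(1) by (simp add: add.assoc)
  moreover have "\<psi> \<sigma> = \<eta> (\<alpha> + \<sigma>) / \<eta> \<alpha>"
    by (rule \<psi>_isotropic[OF \<sigma> \<alpha>(1) \<alpha>\<sigma>(1)])
  moreover have "\<psi> \<tau> = \<eta> (\<alpha> + \<sigma> + \<tau>) / \<eta> (\<alpha> + \<sigma>)"
    by (rule \<psi>_isotropic[OF \<tau> \<alpha>\<sigma>(1) \<alpha>\<sigma>\<tau>(1)])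
  ultimately show ?thesis
    using \<eta>_nonzero[OF \<alpha>\<sigma>(1)] by simp
qed

theorem assoc_core_character_is_character: "is_character \<psi>"
  unfolding is_character_def
proof (intro conjI ballI impI)
  fix \<alpha> assume "\<alpha> \<in> roots"
  then show "\<psi> \<alpha> \<noteq> 0"
    by (rule \<psi>_nonzero)
next
  fix \<alpha> \<beta> assume r: "\<alpha> \<in> roots" "\<beta> \<in> roots" "\<alpha> + \<beta> \<in> roots"
  have iso: "\<gamma> \<in> isotropic_roots \<longleftrightarrow> \<gamma> \<notin> nonisotropic_roots" if "\<gamma> \<in> roots" for \<gamma>
    using that by (auto simp: nonisotropic_roots_def)
  consider "\<alpha> \<in> nonisotropic_roots" "\<beta> \<in> nonisotropic_roots"
    | "\<alpha> \<in> nonisotropic_roots" "\<beta> \<in> isotropic_roots"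
    | "\<alpha> \<in> isotropic_roots" "\<beta> \<in> nonisotropic_roots"
    | "\<alpha> \<in> isotropic_roots" "\<beta> \<in> isotropic_roots"
    using iso r by blast
  then show "\<psi> (\<alpha> + \<beta>) = \<psi> \<alpha> * \<psi> \<beta>"
  proof cases
    case 1
    then show ?thesis
      using \<psi>_add_nonisotropic r by blast
  next
    case 2
    then show ?thesis
      using \<psi>_add_isotropic r by blast
  next
    case 3
    then show ?thesis
      using \<psi>_add_isotropic[of \<beta> \<alpha>] r by (simp add: add.commute mult.commute)
  next
    case 4
    then have "bar (\<alpha> + \<beta>) = 0"
      using r by (simp add: bar_add_isotropic bar_isotropic)
    then have "\<alpha> + \<beta> \<in> isotropic_roots"
      using r(3) zero_notin_\<Phi> by (simp add: iso nonisotropic_iff_bar)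
    then show ?thesis
      using 4 \<psi>_add_isotropic_isotropic by blast
  qed
qed

text \<open>
  On the span of \<open>x\<close> and \<open>z\<close> one has \<open>\<Psi>\<^sup>k x = c\<^sup>k x + k c\<^sup>k\<^sup>-\<^sup>1 z\<close> and \<open>\<Psi>\<^sup>k z = c\<^sup>k z\<close>; a \<open>k > 0\<close> with \<open>\<Psi>\<^sup>k = id\<close>
  gives \<open>k z = 0\<close>.
\<close>

lemma no_generalized_eigenvector:
  assumes x: "\<Psi> x = scale c x + z" and z: "\<Psi> z = scale c z" and c: "c \<noteq> 0"
  shows "z = 0"
proof -
  obtain n where n: "n > 0" "\<Psi> ^^ n = id"
    using finite_order by (auto simp: finite_order_def)
  have pow_z: "(\<Psi> ^^ k) z = scale (c ^ k) z" for k
    by (induction k) (simp_all add: \<Psi>.scale z mult.commute)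
  \<comment> \<open>scaled by \<open>c\<close>, to avoid the exponent \<open>k - 1\<close>\<close>
  have pow_x: "scale c ((\<Psi> ^^ k) x) = scale (c ^ Suc k) x + scale (of_nat k * c ^ k) z" for k
  proof (induction k)
    case (Suc k)
    have "scale c ((\<Psi> ^^ Suc k) x) = \<Psi> (scale c ((\<Psi> ^^ k) x))"
      by (simp add: \<Psi>.scale)
    also have "\<dots> = scale (c ^ Suc k) (scale c x + z) + scale (of_nat k * c ^ k) (scale c z)"
      unfolding Suc by (simp only: \<Psi>.add \<Psi>.scale x z)
    also have "\<dots> = scale (c ^ Suc (Suc k)) x + scale (of_nat (Suc k) * c ^ Suc k) z"
      by (simp add: scale_right_distrib scale_left_distrib algebra_simps)
    finally show ?case .
  qed simp
  show ?thesis
  proof (rule ccontr)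
    assume "z \<noteq> 0"
    have "scale (c ^ n) z = scale 1 z"
      using pow_z[of n] n(2) by simp
    with \<open>z \<noteq> 0\<close> have "c ^ n = 1"
      using scale_right_imp_eq by blast
    then have "scale (of_nat n) z = 0"
      using pow_x[of n] n(2) by simp
    then show False
      using n(1) \<open>z \<noteq> 0\<close> by simp
  qed
qed

text \<open>
  For \<open>x \<in> E\<^sub>\<sigma>\<close>, both \<open>\<Psi> x\<close> and \<open>\<psi>(\<sigma>) x\<close> have the same brackets with non-isotropic root vectors, so
  their difference centralizes the core and lies in it by tameness. On the core part of \<open>E\<^sub>\<sigma>\<close> the
  automorphism is the scalar \<open>\<psi>(\<sigma>)\<close>, and finite order excludes a nontrivial Jordan block.
\<close>

lemma \<Psi>_isotropic:
  assumes \<sigma>: "\<sigma> \<in> isotropic_roots" and x: "x \<in> root_space \<sigma>"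
  shows "\<Psi> x = scale (\<psi> \<sigma>) x"
proof -
  define T where "T = (\<lambda>y. \<Psi> y - scale (\<psi> \<sigma>) y)"
  have T_root_space: "T y \<in> root_space \<gamma>" if "y \<in> root_space \<gamma>" for y \<gamma>
    using that by (simp add: T_def root_space_diff root_space_scale \<Psi>_root_space)
  have \<sigma>r: "\<sigma> \<in> roots"
    using \<sigma> by (simp add: isotropic_iff)
  have "T x \<in> core"
  proof (rule centralizer_coreI)
    fix \<alpha> u assume \<alpha>: "\<alpha> \<in> nonisotropic_roots" and u: "u \<in> root_space \<alpha>"
    have xu: "bracket x u \<in> root_space (\<alpha> + \<sigma>)"
      using bracket_root_space[OF x u] by (simp add: add.commute)
    show "bracket (T x) u = 0"
    proof (cases "\<alpha> + \<sigma> \<in> roots")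
      case False
      have "bracket (T x) u \<in> root_space (\<alpha> + \<sigma>)"
        using bracket_root_space[OF T_root_space[OF x] u] by (simp add: add.commute)
      then show ?thesis
        using False rootI \<alpha> \<sigma>r dual_add nonisotropic_root roots_dual by blast
    next
      case True
      then have \<alpha>\<sigma>: "\<alpha> + \<sigma> \<in> nonisotropic_roots"
        using nonisotropic_add_isotropic \<alpha> \<sigma> by blast
      have "scale (\<eta> \<alpha>) (bracket (\<Psi> x) u) = \<Psi> (bracket x u)"
        by (simp add: \<Psi>_bracket \<Psi>_nonisotropic[OF \<alpha> u] bracket_scale_right)
      also have "\<dots> = scale (\<eta> \<alpha>) (scale (\<psi> \<sigma>) (bracket x u))"
        using \<eta>_nonzero[OF \<alpha>] by (simp add: \<Psi>_nonisotropic[OF \<alpha>\<sigma> xu] \<psi>_isotropic[OF \<sigma> \<alpha> \<alpha>\<sigma>])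
      finally have "bracket (\<Psi> x) u = scale (\<psi> \<sigma>) (bracket x u)"
        using \<eta>_nonzero[OF \<alpha>] by (simp only: scale_cancel_left) simp
      then show ?thesis
        by (simp add: T_def bracket_diff_left bracket_scale_left)
    qed
  qed
  moreover have "T (bracket y z) = 0"
    if \<alpha>: "\<alpha> \<in> nonisotropic_roots" "\<beta> \<in> nonisotropic_roots" "\<alpha> + \<beta> = \<sigma>"
      "y \<in> root_space \<alpha>" "z \<in> root_space \<beta>" for \<alpha> \<beta> y z
  proof -
    have "\<psi> \<sigma> = \<eta> \<alpha> * \<eta> \<beta>"
      using \<psi>_add_nonisotropic[OF \<alpha>(1,2)] \<alpha> \<sigma>r by (simp add: \<psi>_nonisotropic)
    then show ?thesis
      using \<Psi>_bracket_nonisotropic[OF \<alpha>(1,2,4,5)] by (simp add: T_def)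
  qed
  ultimately have "T (T x) = 0"
    using core_isotropic_vanish[of T \<sigma> "T x"] T_root_space \<sigma> x
    by (simp add: T_def \<Psi>.add \<Psi>.scale scale_right_distrib scale_right_diff_distrib mult.commute)
  then have "\<Psi> (T x) = scale (\<psi> \<sigma>) (T x)"
    by (simp add: T_def)
  then have "T x = 0"
    using no_generalized_eigenvector[of x "\<psi> \<sigma>" "T x"] \<psi>_nonzero[OF \<sigma>r] by (simp add: T_def)
  then show ?thesis
    by (simp add: T_def)
qed

theorem diagonal: "diagonal \<Psi>"
  unfolding diagonal_def
proof
  fix \<alpha> assume "\<alpha> \<in> roots"
  then consider "\<alpha> \<in> nonisotropic_roots" | "\<alpha> \<in> isotropic_roots"
    by (auto simp: nonisotropic_roots_def)
  then show "\<exists>c. \<forall>x\<in>root_space \<alpha>. \<Psi> x = scale c x"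
    using \<Psi>_nonisotropic \<Psi>_isotropic by cases blast+
qed

end

section \<open>Hubs of the standard root systems\<close>

lemma obtuseI:
  assumes "k > 0" "b + scale_fun (real k) a \<in> \<Phi>" "b - scale_fun (real k) a \<notin> insert 0 \<Phi>"
  shows "obtuse \<Phi> b a"
  using assms by (auto simp: obtuse_def)

lemma obtuse_stepI:
  assumes "a \<in> \<Phi>" "b \<in> \<Phi>" "b - a \<in> \<Phi>" "obtuse \<Phi> a (b - a)"
  shows "(a, b) \<in> obtuse_step \<Phi>"
  using assms by (auto simp: obtuse_step_def intro!: exI[of _ "b - a"])

abbreviation uvec :: "real \<Rightarrow> nat \<Rightarrow> nat \<Rightarrow> real"
  where "uvec s i \<equiv> scale_fun s (unit_vec i)"

lemma unit_vec_apply [simp]: "unit_vec i j = (if j = i then 1 else 0)"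
  by (simp add: unit_vec_def)

lemma scale_fun_apply: "scale_fun r f x = r *\<^sub>R f x"
  by (simp add: scale_fun_def)

subsection \<open>Type C\<close>

lemma roots_C_short:
  "i < l \<Longrightarrow> j < l \<Longrightarrow> i \<noteq> j \<Longrightarrow> s \<in> {1, -1} \<Longrightarrow> t \<in> {1, -1} \<Longrightarrow> uvec s i + uvec t j \<in> roots_C l"
  unfolding roots_C_def by blast

lemma roots_C_long: "i < l \<Longrightarrow> s \<in> {2, -2} \<Longrightarrow> uvec s i \<in> roots_C l"
  unfolding roots_C_def by blast

lemma roots_C_support:
  assumes "v \<in> insert 0 (roots_C l)" "i \<noteq> j" "i \<noteq> k" "j \<noteq> k"
  shows "v i = 0 \<or> v j = 0 \<or> v k = 0"
  using assms by (auto simp: roots_C_def scale_fun_apply split: if_splits)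

lemma roots_C_coord:
  assumes "v \<in> insert 0 (roots_C l)"
  shows "\<bar>v i\<bar> \<le> 2"
  using assms by (auto simp: roots_C_def scale_fun_apply)

lemma zero_notin_roots_C: "0 \<notin> roots_C l"
proof
  assume "0 \<in> roots_C l"
  then consider a b i j where "i \<noteq> j" "a \<in> {1, -1}" "0 = uvec a i + uvec b j"
    | a i where "a \<in> {2, -2}" "0 = uvec a i"
    unfolding roots_C_def by blast
  then show False
  proof cases
    case 1
    from 1(1,2) fun_cong[OF 1(3), of i] show False
      by (auto simp: scale_fun_apply)
  next
    case 2
    from 2(1) fun_cong[OF 2(2), of i] show False
      by (auto simp: scale_fun_apply)
  qed
qed

lemma roots_C_step:
  assumes "i < l" "j < l" "k < l" "i \<noteq> j" "i \<noteq> k" "j \<noteq> k"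
    and "s \<in> {1, -1}" "t \<in> {1, -1}" "u \<in> {1, -1}"
  shows "(uvec s i + uvec t j, uvec s i + uvec u k) \<in> obtuse_step (roots_C l)"
proof (rule obtuse_stepI)
  let ?a = "uvec s i + uvec t j" and ?b = "uvec s i + uvec u k"
  have c: "?b - ?a = uvec u k + uvec (- t) j"
    by (simp add: fun_eq_iff scale_fun_apply)
  show "?a \<in> roots_C l" and b: "?b \<in> roots_C l"
    using assms by (auto intro!: roots_C_short simp del: scale_minus_left)
  show "?b - ?a \<in> roots_C l"
    unfolding c using assms by (intro roots_C_short) auto
  show "obtuse (roots_C l) ?a (?b - ?a)"
  proof (rule obtuseI[of 1])
    show "?a + scale_fun (real 1) (?b - ?a) \<in> roots_C l"
      using b by simp
    show "?a - scale_fun (real 1) (?b - ?a) \<notin> insert 0 (roots_C l)"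
      using roots_C_support[of "?a - scale_fun (real 1) (?b - ?a)" l i j k] assms
      by (auto simp: scale_fun_apply)
  qed simp
qed

lemma roots_C_steps:
  assumes l: "l \<ge> 3" and "i < l" "j < l" "k < l" "i \<noteq> j" "i \<noteq> k"
    and "s \<in> {1, -1}" "t \<in> {1, -1}" "u \<in> {1, -1}"
  shows "(uvec s i + uvec t j, uvec s i + uvec u k) \<in> (obtuse_step (roots_C l))\<^sup>*"
proof (cases "j = k")
  case False
  then show ?thesis
    using roots_C_step assms by blast
next
  case True
  have "\<exists>m\<in>{0, 1, 2}. m \<noteq> i \<and> m \<noteq> j"
    by auto
  then obtain m where "m \<in> {0, 1, 2}" and m: "m \<noteq> i" "m \<noteq> j"
    by blast
  with l have "m < l"
    by auto
  note m = this m
  have "(uvec s i + uvec t j, uvec s i + uvec 1 m) \<in> obtuse_step (roots_C l)"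
    using m assms by (intro roots_C_step) auto
  moreover have "(uvec s i + uvec 1 m, uvec s i + uvec u k) \<in> obtuse_step (roots_C l)"
    using m assms True by (intro roots_C_step) auto
  ultimately show ?thesis
    by (meson r_into_rtrancl rtrancl_trans)
qed

text \<open>
  The hub is the short root \<open>e\<^sub>0 + e\<^sub>1\<close>. A long root \<open>2 s e\<^sub>i\<close> leads to a short one \<open>s e\<^sub>i + e\<^sub>j\<close>, and a
  short root leads to the hub by replacing one of its two entries at a time. A third coordinate, and
  hence \<open>l \<ge> 3\<close>, is used to change a sign and for the subsystem of type \<open>A\<^sub>2\<close>, spanned by the hub
  and \<open>e\<^sub>2 - e\<^sub>1\<close>.
\<close>

lemma is_hub_roots_C:
  assumes l: "l \<ge> 3"
  shows "is_hub (roots_C l) (uvec 1 0 + uvec 1 1)"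
  unfolding is_hub_def
proof (intro conjI ballI)
  let ?S = "(obtuse_step (roots_C l))\<^sup>*" and ?a = "uvec 1 0 + uvec 1 1"
  show "?a \<in> roots_C l"
    using l by (intro roots_C_short) auto
  have reach1: "(uvec s i + uvec t j, ?a) \<in> ?S"
    if "i < l" "j < l" "i \<noteq> j" "s \<in> {1, -1}" "t \<in> {1, -1}" "i \<noteq> 0" for s t i j
  proof -
    have "(uvec s i + uvec t j, uvec s i + uvec 1 0) \<in> ?S"
      using l that by (intro roots_C_steps) auto
    also have "uvec s i + uvec 1 0 = uvec 1 0 + uvec s i"
      by (rule add.commute)
    also have "(uvec 1 0 + uvec s i, ?a) \<in> ?S"
      using l that by (intro roots_C_steps) auto
    finally show ?thesis .
  qed
  have short: "(uvec s i + uvec t j, ?a) \<in> ?S"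
    if "i < l" "j < l" "i \<noteq> j" "s \<in> {1, -1}" "t \<in> {1, -1}" for s t i j
    using reach1[of i j s t] reach1[of j i t s] that by (cases "i = 0") (auto simp: add.commute)
  fix b assume "b \<in> roots_C l"
  then consider s t i j where "i < l" "j < l" "i \<noteq> j" "s \<in> {1, -1}" "t \<in> {1, -1}" "b = uvec s i + uvec t j"
    | s i where "i < l" "s \<in> {2, -2}" "b = uvec s i"
    unfolding roots_C_def by blast
  then show "(b, ?a) \<in> ?S"
  proof cases
    case 1
    then show ?thesis
      using short by blast
  next
    case 2
    have "\<exists>m\<in>{0, 1}. m \<noteq> i"
      by auto
    then obtain j where "j \<in> {0, 1}" and j: "j \<noteq> i"
      by blast
    with l have "j < l"
      by auto
    note j = this j
    define b' where "b' = uvec (s / 2) i + uvec 1 j"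
    have c: "b' - b = uvec 1 j + uvec (- s / 2) i"
      by (simp add: fun_eq_iff scale_fun_apply 2 b'_def)
    have b': "b' \<in> roots_C l"
      unfolding b'_def using 2 j by (intro roots_C_short) auto
    have "(b, b') \<in> obtuse_step (roots_C l)"
    proof (rule obtuse_stepI)
      show "b \<in> roots_C l"
        using 2 roots_C_long by blast
      show "b' - b \<in> roots_C l"
        unfolding c using 2 j by (intro roots_C_short) auto
      show "obtuse (roots_C l) b (b' - b)"
      proof (rule obtuseI[of 1])
        show "b - scale_fun (real 1) (b' - b) \<notin> insert 0 (roots_C l)"
          using roots_C_coord[of "b - scale_fun (real 1) (b' - b)" l i] 2 j
          by (auto simp: scale_fun_apply b'_def)
      qed (use b' in simp_all)
    qed (rule b')
    moreover have "(b', ?a) \<in> ?S"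
      unfolding b'_def using 2 j by (intro short) auto
    ultimately show ?thesis
      by (rule converse_rtrancl_into_rtrancl)
  qed
next
  let ?\<Phi> = "roots_C l" and ?a = "uvec 1 0 + uvec 1 1"
  define c where "c = uvec 1 2 + uvec (- 1) 1"
  have ac: "?a + c = uvec 1 0 + uvec 1 2" and d: "- c - ?a = uvec (- 1) 0 + uvec (- 1) 2"
    by (simp_all add: c_def fun_eq_iff scale_fun_apply)
  have nc: "- c = uvec (- 1) 2 + uvec 1 1"
    by (simp add: c_def fun_eq_iff scale_fun_apply)
  have ac_root: "?a + c \<in> ?\<Phi>"
    unfolding ac using l by (intro roots_C_short) auto
  have "obtuse ?\<Phi> ?a c"
  proof (rule obtuseI[of 1])
    show "?a + scale_fun (real 1) c \<in> ?\<Phi>"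
      using ac_root by simp
    show "?a - scale_fun (real 1) c \<notin> insert 0 ?\<Phi>"
      using roots_C_support[of "?a - scale_fun (real 1) c" l 0 1 2] by (auto simp: c_def scale_fun_apply)
  qed simp
  moreover have "obtuse ?\<Phi> ?a (- c - ?a)"
  proof (rule obtuseI[of 1])
    show "?a + scale_fun (real 1) (- c - ?a) \<in> ?\<Phi>"
      using l roots_C_short[of 2 l 1 "-1" 1] by (simp add: nc)
    show "?a - scale_fun (real 1) (- c - ?a) \<notin> insert 0 ?\<Phi>"
      using roots_C_support[of "?a - scale_fun (real 1) (- c - ?a)" l 0 1 2]
      by (auto simp: c_def scale_fun_apply)
  qed simp
  moreover have "obtuse ?\<Phi> (?a + c) (- c)"
  proof (rule obtuseI[of 1])
    show "?a + c + scale_fun (real 1) (- c) \<in> ?\<Phi>"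
      using l roots_C_short[of 0 l 1 1 1] by simp
    show "?a + c - scale_fun (real 1) (- c) \<notin> insert 0 ?\<Phi>"
      using roots_C_support[of "?a + c - scale_fun (real 1) (- c)" l 0 1 2]
      by (auto simp: c_def scale_fun_apply)
  qed simp
  moreover have "c \<in> ?\<Phi>"
    unfolding c_def using l by (intro roots_C_short) auto
  moreover note ac_root
  ultimately show "\<exists>c\<in>?\<Phi>. ?a + c \<in> ?\<Phi> \<and> obtuse ?\<Phi> ?a c \<and> obtuse ?\<Phi> ?a (- c - ?a) \<and>
      obtuse ?\<Phi> (?a + c) (- c)"
    by blast
qed

subsection \<open>Type F\<close>

lemma roots_F4_short: "i < 4 \<Longrightarrow> s \<in> {1, -1} \<Longrightarrow> uvec s i \<in> roots_F4"
  unfolding roots_F4_def by blast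

definition half_vec :: "(nat \<Rightarrow> real) \<Rightarrow> bool"
  where "half_vec v \<longleftrightarrow> (\<forall>i<4. \<bar>v i\<bar> = 1 / 2) \<and> (\<forall>i\<ge>4. v i = 0)"

lemma half_vecI: "(\<And>i. i < 4 \<Longrightarrow> \<bar>v i\<bar> = 1 / 2) \<Longrightarrow> (\<And>i. i \<ge> 4 \<Longrightarrow> v i = 0) \<Longrightarrow> half_vec v"
  by (simp add: half_vec_def)

lemma half_vec_abs: "half_vec v \<Longrightarrow> i < 4 \<Longrightarrow> \<bar>v i\<bar> = 1 / 2"
  and half_vec_outside: "half_vec v \<Longrightarrow> i \<ge> 4 \<Longrightarrow> v i = 0"
  by (simp_all add: half_vec_def)

lemma half_vec_iff:
  "half_vec v \<longleftrightarrow> (\<forall>i<4. v i \<in> {1 / 2, - 1 / 2}) \<and> (\<forall>i\<ge>4. v i = 0)"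
proof -
  have "\<bar>x\<bar> = 1 / 2 \<longleftrightarrow> x \<in> {1 / 2, - 1 / 2}" for x :: real
    by (auto simp: abs_if)
  then show ?thesis
    by (simp only: half_vec_def)
qed

lemma half_vec_root: "half_vec v \<Longrightarrow> v \<in> roots_F4"
  unfolding roots_F4_def half_vec_iff by blast

lemma roots_F4_cases:
  assumes "v \<in> roots_F4"
  obtains (short) s i where "i < 4" "s \<in> {1, -1}" "v = uvec s i"
    | (long) s t i j where "i < 4" "j < 4" "i \<noteq> j" "s \<in> {1, -1}" "t \<in> {1, -1}"
        "v = uvec s i + uvec t j"
    | (half) "half_vec v"
  using assms unfolding roots_F4_def half_vec_iff by blast

lemma roots_F4_coord:
  assumes "v \<in> insert 0 roots_F4"
  shows "\<bar>v m\<bar> \<le> 1"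
proof (cases "v = 0")
  case False
  with assms have "v \<in> roots_F4"
    by simp
  then show ?thesis
  proof (cases rule: roots_F4_cases)
    case (short s i)
    then show ?thesis
      by (auto simp: scale_fun_apply)
  next
    case (long s t i j)
    show ?thesis
      using long(3-5) unfolding long(6) by (auto simp: scale_fun_apply)
  next
    case half
    then show ?thesis
      using half_vec_abs[OF half, of m] half_vec_outside[OF half, of m] by (cases "m < 4") simp_all
  qed
qed simp

lemma roots_F4_support:
  assumes "v \<in> insert 0 roots_F4" "i < 4" "i \<noteq> j" "i \<noteq> k" "j \<noteq> k"
    and v: "\<bar>v i\<bar> = 1" "\<bar>v j\<bar> = 1" "\<bar>v k\<bar> = 1"
  shows False
proof -
  have "v \<noteq> 0"
    using v(1) by auto
  with assms(1) have "v \<in> roots_F4"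
    by simp
  then show ?thesis
  proof (cases rule: roots_F4_cases)
    case (short s p)
    then show ?thesis
      using v(1,2) assms(3) by (simp add: scale_fun_apply split: if_splits)
  next
    case (long s t p q)
    have "m = p \<or> m = q" if "\<bar>v m\<bar> = 1" for m
      using that unfolding long(6) by (simp add: scale_fun_apply split: if_splits)
    then show ?thesis
      using v assms(3-5) by metis
  next
    case half
    then show ?thesis
      using half_vec_abs[OF half assms(2)] v(1) by simp
  qed
qed

lemma zero_notin_roots_F4: "0 \<notin> roots_F4"
proof
  assume "0 \<in> roots_F4"
  then show False
  proof (cases rule: roots_F4_cases)
    case (short s i)
    then show ?thesis
      using fun_cong[OF short(3), of i] by (auto simp: scale_fun_apply)
  next
    case (long s t i j)
    show ?thesis
      using long(3,4) fun_cong[OF long(6), of i] by (auto simp: scale_fun_apply)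
  next
    case half
    then show ?thesis
      using half_vec_abs[OF half, of 0] by simp
  qed
qed

lemma half_vec_sign:
  assumes "half_vec h" "i < 4" "h i = s / 2"
  shows "s \<in> {1, -1}"
  using half_vec_abs[OF assms(1,2)] assms(3) by (auto simp: abs_if split: if_splits)

lemma half_vec_reflect:
  assumes h: "half_vec h" and i: "i < 4" "h i = s / 2"
  shows "half_vec (h - uvec s i)" "half_vec (uvec s i - h)"
proof -
  have s: "s \<in> {1, -1}"
    by (rule half_vec_sign[OF assms])
  have m: "\<bar>h m - s * (if m = i then 1 else 0)\<bar> = 1 / 2" if "m < 4" for m
    using half_vec_abs[OF h that] i(2) s by (cases "m = i") auto
  show "half_vec (h - uvec s i)"
    using m half_vec_outside[OF h] i(1) by (intro half_vecI) (simp_all add: scale_fun_apply)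
  show "half_vec (uvec s i - h)"
    using m half_vec_outside[OF h] i(1)
    by (intro half_vecI) (simp_all add: scale_fun_apply abs_minus_commute)
qed

lemma roots_F4_half_step:
  assumes h: "half_vec h" and i: "i < 4" "h i = s / 2"
  shows "(h, uvec s i) \<in> obtuse_step roots_F4"
proof (rule obtuse_stepI)
  have s: "s \<in> {1, -1}"
    by (rule half_vec_sign[OF h i])
  show "h \<in> roots_F4"
    by (rule half_vec_root[OF h])
  show u: "uvec s i \<in> roots_F4"
    by (rule roots_F4_short[OF i(1) s])
  show "uvec s i - h \<in> roots_F4"
    by (rule half_vec_root[OF half_vec_reflect(2)[OF h i]])
  show "obtuse roots_F4 h (uvec s i - h)"
  proof (rule obtuseI[of 1])
    obtain j k m where jkm: "j < 4" "k < 4" "m < 4" "j \<noteq> i" "k \<noteq> i" "m \<noteq> i" "j \<noteq> k" "j \<noteq> m" "k \<noteq> m"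
    proof -
      have "i = 0 \<or> i = 1 \<or> i = 2 \<or> i = 3"
        using i(1) by auto
      then show ?thesis
        using that[of 1 2 3] that[of 0 2 3] that[of 0 1 3] that[of 0 1 2] by auto
    qed
    show "h - scale_fun (real 1) (uvec s i - h) \<notin> insert 0 roots_F4"
    proof
      let ?v = "h - scale_fun (real 1) (uvec s i - h)"
      assume v: "?v \<in> insert 0 roots_F4"
      have "\<bar>?v p\<bar> = 1" if "p < 4" "p \<noteq> i" for p
        using half_vec_abs[OF h that(1)] that(2) by (simp add: scale_fun_apply)
      then show False
        using roots_F4_support[OF v jkm(1,7-9)] jkm by blast
    qed
  qed (use u in simp_all)
qed

lemma roots_F4_short_step:
  assumes h: "half_vec h" and i: "i < 4" "h i = s / 2"
  shows "(uvec s i, h) \<in> obtuse_step roots_F4"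
proof (rule obtuse_stepI)
  have s: "s \<in> {1, -1}"
    by (rule half_vec_sign[OF h i])
  show h': "h \<in> roots_F4"
    by (rule half_vec_root[OF h])
  show "uvec s i \<in> roots_F4"
    by (rule roots_F4_short[OF i(1) s])
  show "h - uvec s i \<in> roots_F4"
    by (rule half_vec_root[OF half_vec_reflect(1)[OF h i]])
  show "obtuse roots_F4 (uvec s i) (h - uvec s i)"
  proof (rule obtuseI[of 1])
    show "uvec s i - scale_fun (real 1) (h - uvec s i) \<notin> insert 0 roots_F4"
      using roots_F4_coord[of "uvec s i - scale_fun (real 1) (h - uvec s i)" i] s i(2)
      by (auto simp: scale_fun_apply)
  qed (use h' in simp_all)
qed

text \<open>
  The hub is the short root \<open>e\<^sub>0\<close>. A vector with all entries \<open>1/2\<close> or \<open>-1/2\<close> and the unit vector of any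
  of its entries, with the sign of that entry, are at an angle of 60 degrees, and an obtuse step leads
  from each of the two to the other. From \<open>- e\<^sub>0\<close> the hub is reached through \<open>(-1/2, ..., -1/2)\<close> and
  \<open>- e\<^sub>1\<close>. A long root \<open>s e\<^sub>i + t e\<^sub>j\<close> leads to \<open>s e\<^sub>i\<close>.
\<close>

lemma is_hub_roots_F4: "is_hub roots_F4 (uvec 1 0)"
  unfolding is_hub_def
proof (intro conjI ballI)
  let ?S = "(obtuse_step roots_F4)\<^sup>*" and ?a = "uvec 1 0"
  show "?a \<in> roots_F4"
    by (intro roots_F4_short) auto
  have short: "(uvec s i, ?a) \<in> ?S" if "i < 4" "s \<in> {1, -1}" "i \<noteq> 0" for s i
  proof -
    define h :: "nat \<Rightarrow> real" where "h = (\<lambda>j. if j < 4 then if j = i then s / 2 else 1 / 2 else 0)"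
    have "half_vec h" "h i = s / 2" "h 0 = 1 / 2"
      using that by (auto simp: half_vec_def h_def)
    then have "(uvec s i, h) \<in> obtuse_step roots_F4" "(h, ?a) \<in> obtuse_step roots_F4"
      using that(1) by (simp_all only: roots_F4_short_step roots_F4_half_step)
    then show ?thesis
      by (meson r_into_rtrancl rtrancl_trans)
  qed
  have half_reach: "(h, ?a) \<in> ?S" if h: "half_vec h" for h
  proof -
    have "(h, uvec (2 * h 1) 1) \<in> obtuse_step roots_F4"
      by (rule roots_F4_half_step[OF h]) auto
    moreover have "(uvec (2 * h 1) 1, ?a) \<in> ?S"
      using half_vec_sign[OF h, of 1 "2 * h 1"] by (intro short) auto
    ultimately show ?thesis
      by (rule converse_rtrancl_into_rtrancl)
  qed
  have short': "(uvec s i, ?a) \<in> ?S" if "i < 4" "s \<in> {1, -1}" for s i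
  proof -
    define h :: "nat \<Rightarrow> real" where "h = (\<lambda>j. if j < 4 then s / 2 else 0)"
    have h: "half_vec h" "h i = s / 2"
      using that by (auto simp: half_vec_def h_def)
    show ?thesis
      using roots_F4_short_step[OF h(1) that(1) h(2)] half_reach[OF h(1)]
      by (rule converse_rtrancl_into_rtrancl)
  qed
  fix b assume b: "b \<in> roots_F4"
  then show "(b, ?a) \<in> ?S"
  proof (cases rule: roots_F4_cases)
    case short
    then show ?thesis
      using short' by blast
  next
    case half
    then show ?thesis
      using half_reach by blast
  next
    case (long s t i j)
    have c: "uvec s i - b = uvec (- t) j"
      by (simp add: long fun_eq_iff scale_fun_apply)
    have u: "uvec s i \<in> roots_F4" "uvec (- t) j \<in> roots_F4"
      using long by (auto intro!: roots_F4_short simp del: real_fun.scale_minus_left)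
    have "(b, uvec s i) \<in> obtuse_step roots_F4"
    proof (rule obtuse_stepI)
      show "obtuse roots_F4 b (uvec s i - b)"
      proof (rule obtuseI[of 1])
        show "b - scale_fun (real 1) (uvec s i - b) \<notin> insert 0 roots_F4"
          using roots_F4_coord[of "b - scale_fun (real 1) (uvec s i - b)" j] long(3-6)
          by (auto simp: scale_fun_apply)
      qed (use u in simp_all)
    qed (use b u c in simp_all)
    then show ?thesis
      using short'[OF long(1,4)] by (rule converse_rtrancl_into_rtrancl)
  qed
next
  let ?a = "uvec 1 0"
  define c :: "nat \<Rightarrow> real" where "c = (\<lambda>j. if j < 4 then if j = 0 then - 1 / 2 else 1 / 2 else 0)"
  have c: "half_vec c" and ac: "half_vec (?a + c)" and nc: "half_vec (- c)"
    by (auto intro!: half_vecI simp: c_def scale_fun_apply)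
  have "obtuse roots_F4 ?a c"
  proof (rule obtuseI[of 1])
    show "?a - scale_fun (real 1) c \<notin> insert 0 roots_F4"
      using roots_F4_coord[of "?a - scale_fun (real 1) c" 0] by (auto simp: c_def scale_fun_apply)
  qed (use half_vec_root[OF ac] in simp_all)
  moreover have "obtuse roots_F4 ?a (- c - ?a)"
  proof (rule obtuseI[of 1])
    show "?a - scale_fun (real 1) (- c - ?a) \<notin> insert 0 roots_F4"
      using roots_F4_coord[of "?a - scale_fun (real 1) (- c - ?a)" 0]
      by (auto simp: c_def scale_fun_apply)
  qed (use half_vec_root[OF nc] in simp_all)
  moreover have "obtuse roots_F4 (?a + c) (- c)"
  proof (rule obtuseI[of 1])
    show "?a + c - scale_fun (real 1) (- c) \<notin> insert 0 roots_F4"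
      using roots_F4_support[of "?a + c - scale_fun (real 1) (- c)" 1 2 3]
      by (auto simp: c_def scale_fun_apply)
  qed (use roots_F4_short[of 0 1] in simp_all)
  ultimately show "\<exists>c\<in>roots_F4. ?a + c \<in> roots_F4 \<and> obtuse roots_F4 ?a c \<and>
      obtuse roots_F4 ?a (- c - ?a) \<and> obtuse roots_F4 (?a + c) (- c)"
    using half_vec_root[OF c] half_vec_root[OF ac] by blast
qed

subsection \<open>Type G\<close>

lemma roots_G2_short: "i < 3 \<Longrightarrow> j < 3 \<Longrightarrow> i \<noteq> j \<Longrightarrow> unit_vec i - unit_vec j \<in> roots_G2"
  unfolding roots_G2_def by blast

definition triple_012 :: "nat \<Rightarrow> nat \<Rightarrow> nat \<Rightarrow> bool"
  where "triple_012 i j k \<longleftrightarrow> i < 3 \<and> j < 3 \<and> k < 3 \<and> i \<noteq> j \<and> i \<noteq> k \<and> j \<noteq> k"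

lemma triple_012_iff: "triple_012 i j k \<longleftrightarrow> {i, j, k} = {0, 1, 2}"
proof
  assume ijk: "triple_012 i j k"
  then have "{i, j, k} \<subseteq> {0, 1, 2}"
    unfolding triple_012_def by auto
  moreover have "card {i, j, k} = card {0, 1, 2 :: nat}"
    using ijk unfolding triple_012_def by simp
  ultimately show "{i, j, k} = {0, 1, 2}"
    by (intro card_subset_eq) simp_all
next
  assume eq: "{i, j, k} = {0, 1, 2}"
  have "i \<in> {0, 1, 2}" "j \<in> {0, 1, 2}" "k \<in> {0, 1, 2}"
    unfolding eq[symmetric] by simp_all
  moreover have "card {i, j, k} = 3"
    unfolding eq by simp
  then have "i \<noteq> j" "i \<noteq> k" "j \<noteq> k"
    by (auto simp: card_insert_if split: if_splits)
  ultimately show "triple_012 i j k"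
    unfolding triple_012_def by auto
qed

lemma roots_G2_long:
  "triple_012 i j k \<Longrightarrow> a \<in> {1, -1} \<Longrightarrow>
    scale_fun a (scale_fun 2 (unit_vec i) - unit_vec j - unit_vec k) \<in> roots_G2"
  unfolding roots_G2_def triple_012_iff by blast

lemma roots_G2_cases:
  assumes "v \<in> roots_G2"
  obtains (short) i j where "i < 3" "j < 3" "i \<noteq> j" "v = unit_vec i - unit_vec j"
    | (long) a i j k where "triple_012 i j k" "a \<in> {1, -1}"
        "v = scale_fun a (scale_fun 2 (unit_vec i) - unit_vec j - unit_vec k)"
  using assms unfolding roots_G2_def triple_012_iff by blast

lemma roots_G2_coord:
  assumes "v \<in> insert 0 roots_G2"
  shows "\<bar>v m\<bar> \<le> 2"
proof (cases "v = 0")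
  case False
  with assms have "v \<in> roots_G2"
    by simp
  then show ?thesis
  proof (cases rule: roots_G2_cases)
    case (long a i j k)
    then have "i \<noteq> j" "i \<noteq> k" "j \<noteq> k"
      by (auto simp: triple_012_def)
    then show ?thesis
      using long(2) by (auto simp: long(3) scale_fun_apply)
  qed auto
qed simp

lemma zero_notin_roots_G2: "0 \<notin> roots_G2"
proof
  assume "0 \<in> roots_G2"
  then show False
  proof (cases rule: roots_G2_cases)
    case (short i j)
    show False
      using short(3) fun_cong[OF short(4), of i] by simp
  next
    case (long a i j k)
    then have "i \<noteq> j" "i \<noteq> k"
      by (auto simp: triple_012_def)
    then show False
      using long(2) fun_cong[OF long(3), of i] by (auto simp: scale_fun_apply)
  qed
qed

text \<open>
  The short roots \<open>b = e\<^sub>i - e\<^sub>j\<close> and \<open>a = e\<^sub>j - e\<^sub>k\<close> form an angle of 120 degrees, and \<open>b + a\<close>, \<open>b - a\<close>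
  are both roots. So two steps have to be inspected: \<open>b + 2 a\<close> is a long root, and \<open>b - 2 a\<close> is not a
  root.
\<close>

lemma roots_G2_obtuse_right:
  assumes "triple_012 i j k"
  shows "obtuse roots_G2 (unit_vec i - unit_vec j) (unit_vec j - unit_vec k)"
proof (rule obtuseI[of 2])
  have d: "i \<noteq> j" "i \<noteq> k" "j \<noteq> k"
    using assms by (auto simp: triple_012_def)
  let ?a = "unit_vec i - unit_vec j" and ?c = "unit_vec j - unit_vec k"
  have "?a + scale_fun (real 2) ?c = scale_fun (- 1) (scale_fun 2 (unit_vec k) - unit_vec i - unit_vec j)"
    by (auto simp: fun_eq_iff scale_fun_apply)
  also have "\<dots> \<in> roots_G2"
    using assms by (intro roots_G2_long) (auto simp: triple_012_def)
  finally show "?a + scale_fun (real 2) ?c \<in> roots_G2" .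
  show "?a - scale_fun (real 2) ?c \<notin> insert 0 roots_G2"
    using roots_G2_coord[of "?a - scale_fun (real 2) ?c" j] d by (auto simp: scale_fun_apply)
qed simp

lemma roots_G2_obtuse_left:
  assumes "triple_012 i j k"
  shows "obtuse roots_G2 (unit_vec i - unit_vec j) (unit_vec k - unit_vec i)"
proof (rule obtuseI[of 2])
  have d: "i \<noteq> j" "i \<noteq> k" "j \<noteq> k"
    using assms by (auto simp: triple_012_def)
  let ?a = "unit_vec i - unit_vec j" and ?c = "unit_vec k - unit_vec i"
  have "?a + scale_fun (real 2) ?c = scale_fun 1 (scale_fun 2 (unit_vec k) - unit_vec i - unit_vec j)"
    by (auto simp: fun_eq_iff scale_fun_apply)
  also have "\<dots> \<in> roots_G2"
    using assms by (intro roots_G2_long) (auto simp: triple_012_def)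
  finally show "?a + scale_fun (real 2) ?c \<in> roots_G2" .
  show "?a - scale_fun (real 2) ?c \<notin> insert 0 roots_G2"
    using roots_G2_coord[of "?a - scale_fun (real 2) ?c" i] d by (auto simp: scale_fun_apply)
qed simp

lemma roots_G2_step_right:
  assumes "triple_012 i j k"
  shows "(unit_vec i - unit_vec j, unit_vec i - unit_vec k) \<in> obtuse_step roots_G2"
  using assms roots_G2_obtuse_right[OF assms]
  by (intro obtuse_stepI) (simp_all add: roots_G2_short triple_012_def)

lemma roots_G2_step_left:
  assumes "triple_012 i j k"
  shows "(unit_vec i - unit_vec j, unit_vec k - unit_vec j) \<in> obtuse_step roots_G2"
  using assms roots_G2_obtuse_left[OF assms]
  by (intro obtuse_stepI) (simp_all add: roots_G2_short triple_012_def)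

text \<open>
  The steps to the right and to the left take a short root to its two neighbours in the hexagon of
  short roots. A long root leads to an adjacent short root.
\<close>

lemma is_hub_roots_G2: "is_hub roots_G2 (unit_vec 0 - unit_vec 1)"
  unfolding is_hub_def
proof (intro conjI ballI)
  let ?S = "(obtuse_step roots_G2)\<^sup>*" and ?a = "unit_vec 0 - unit_vec 1"
  show "?a \<in> roots_G2"
    by (intro roots_G2_short) auto
  have reach: "(unit_vec i - unit_vec j, ?a) \<in> ?S" if "i < 3" "j < 3" "i \<noteq> j" for i j
  proof -
    have 02: "(unit_vec 0 - unit_vec 2, ?a) \<in> ?S" and 21: "(unit_vec 2 - unit_vec 1, ?a) \<in> ?S"
      using roots_G2_step_right[of 0 2 1] roots_G2_step_left[of 2 1 0]
      by (simp_all add: triple_012_def r_into_rtrancl)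
    have 12: "(unit_vec 1 - unit_vec 2, ?a) \<in> ?S" and 20: "(unit_vec 2 - unit_vec 0, ?a) \<in> ?S"
      using converse_rtrancl_into_rtrancl[OF roots_G2_step_left[of 1 2 0] 02]
        converse_rtrancl_into_rtrancl[OF roots_G2_step_right[of 2 0 1] 21]
      by (simp_all add: triple_012_def)
    have 10: "(unit_vec 1 - unit_vec 0, ?a) \<in> ?S"
      using converse_rtrancl_into_rtrancl[OF roots_G2_step_right[of 1 0 2] 12]
      by (simp add: triple_012_def)
    have "i = 0 \<or> i = 1 \<or> i = 2" "j = 0 \<or> j = 1 \<or> j = 2"
      using that by auto
    then show ?thesis
      using 02 21 12 20 10 that(3) by auto
  qed
  fix b assume b: "b \<in> roots_G2"
  then show "(b, ?a) \<in> ?S"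
  proof (cases rule: roots_G2_cases)
    case (short i j)
    then show ?thesis
      using reach by blast
  next
    case (long a i j k)
    have d: "i < 3" "j < 3" "k < 3" "i \<noteq> j" "i \<noteq> k" "j \<noteq> k"
      using long(1) by (auto simp: triple_012_def)
    define b' where "b' = scale_fun a (unit_vec i - unit_vec k)"
    have c: "b' - b = scale_fun a (unit_vec j - unit_vec i)"
      by (simp add: b'_def long fun_eq_iff scale_fun_apply algebra_simps)
    have sh: "scale_fun a (unit_vec p - unit_vec q) \<in> {unit_vec p - unit_vec q, unit_vec q - unit_vec p}" for p q
      using long(2) by auto
    have b': "b' \<in> roots_G2" "b' - b \<in> roots_G2" "(b', ?a) \<in> ?S"
      using sh[of i k] sh[of j i] d roots_G2_short reach unfolding b'_def[symmetric] c by auto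
    have "(b, b') \<in> obtuse_step roots_G2"
    proof (rule obtuse_stepI)
      show "obtuse roots_G2 b (b' - b)"
      proof (rule obtuseI[of 1])
        show "b - scale_fun (real 1) (b' - b) \<notin> insert 0 roots_G2"
          using roots_G2_coord[of "b - scale_fun (real 1) (b' - b)" i] d long(2,3)
          by (auto simp: scale_fun_apply b'_def)
      qed (use b' in simp_all)
    qed (rule b b')+
    then show ?thesis
      using b'(3) by (rule converse_rtrancl_into_rtrancl)
  qed
next
  let ?a = "unit_vec 0 - unit_vec 1"
  define c where "c = unit_vec 1 - unit_vec 2"
  have eq: "?a + c = unit_vec 0 - unit_vec 2" "- c - ?a = unit_vec 2 - unit_vec 0"
      "- c = unit_vec 2 - unit_vec 1"
    by (simp_all add: c_def)
  have "obtuse roots_G2 ?a c"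
    unfolding c_def by (rule roots_G2_obtuse_right) (simp add: triple_012_def)
  moreover have "obtuse roots_G2 ?a (- c - ?a)"
    unfolding eq(2) by (rule roots_G2_obtuse_left) (simp add: triple_012_def)
  moreover have "obtuse roots_G2 (?a + c) (- c)"
    unfolding eq(1,3) by (rule roots_G2_obtuse_right) (simp add: triple_012_def)
  moreover have "c \<in> roots_G2" "?a + c \<in> roots_G2"
    unfolding eq unfolding c_def by (auto intro: roots_G2_short)
  ultimately show "\<exists>c\<in>roots_G2. ?a + c \<in> roots_G2 \<and> obtuse roots_G2 ?a c \<and>
      obtuse roots_G2 ?a (- c - ?a) \<and> obtuse roots_G2 (?a + c) (- c)"
    by blast
qed

section \<open>Finite order Cartan automorphisms in types C, F and G\<close>

lemma (in extended_affine_lie_algebra) diagonal_character_of_hub: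
  assumes "has_type \<Phi>" "0 \<notin> \<Phi>" "is_hub \<Phi> a" "cartan_automorphism \<Psi>" "finite_order \<Psi>"
  shows "diagonal \<Psi> \<and> is_character (assoc_core_character \<Psi>)"
proof -
  obtain bar where "eala_with_quotient_map scale bracket form H \<Phi> bar"
    using has_type_quotient_mapE[OF assms(1,2)] .
  then interpret q: eala_with_quotient_map scale bracket form H \<Phi> bar .
  interpret eala_hub_cartan scale bracket form H \<Phi> bar \<Psi> a
    by standard (use assms in simp_all)
  show ?thesis
    using diagonal assoc_core_character_is_character by blast
qed

theorem proposition4p3p4:
  fixes scale :: "complex \<Rightarrow> 'e::ab_group_add \<Rightarrow> 'e"
    and bracket :: "'e \<Rightarrow> 'e \<Rightarrow> 'e"
    and form :: "'e \<Rightarrow> 'e \<Rightarrow> complex"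
    and H :: "'e set"
    and \<Psi> :: "'e \<Rightarrow> 'e"
  assumes "extended_affine_lie_algebra scale bracket form H"
    and "lie_algebra_with_form.reduced_type scale bracket form H"
    and "(\<exists>l\<ge>3. lie_algebra_with_form.has_type scale bracket form H (roots_C l)) \<or>
         lie_algebra_with_form.has_type scale bracket form H roots_F4 \<or>
         lie_algebra_with_form.has_type scale bracket form H roots_G2"
    and "lie_algebra_with_form.cartan_automorphism scale bracket H \<Psi>"
    and "finite_order \<Psi>"
  shows "lie_algebra_with_form.diagonal scale bracket H \<Psi> \<and>
         lie_algebra_with_form.is_character scale bracket H
           (lie_algebra_with_form.assoc_core_character scale bracket form H \<Psi>)"
proof -
  interpret extended_affine_lie_algebra scale bracket form H
    by (rule assms(1))
  show ?thesis
    using assms(3) diagonal_character_of_hub[OF _ _ _ assms(4,5)] is_hub_roots_C zero_notin_roots_C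
      is_hub_roots_F4 zero_notin_roots_F4 is_hub_roots_G2 zero_notin_roots_G2 by blast
qed

end
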